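(* For a real function $f$ on $(0,+\infty)$ that is normalized, $\int_0^{+\infty}f^2(r)\,dr=1$, put $$\langle\hat Z^{(6)}\rangle=\frac{1}{560}\int_0^{+\infty}\left(r f'(r)+9r^2f''(r)+\frac92 r^3f'''(r)\right)^2dr .$$ Then the infimum over all normalized functions $f$ is $$\inf\langle\hat Z^{(6)}\rangle=\frac{35}{4096}.$$ A family of functions that approach this infimum can be constructed with the help of the functions $f^{(4)}_\xi$, $0<\xi<1$, defined in the context (the functions obtained in the four-partite case).
   Context: $\|f\|^2=\int_0^{+\infty}f^2(r)\,dr$. The functional $\langle\hat Z^{(6)}\rangle$ is the one that arises for $N=2n=6$ subsystems, $n=3$; the previous case is $N=4$, $n=2$, in which one minimizes $\|rf'+a r^2f''\|^2$ over normalized $f$ (with $a=2$ for the four-partite problem itself). The functions obtained in that case are, for $0<\xi<1$ and a parameter $a\geqslant 1$, $f^{(4)}_\xi(r)=g_\xi(r)/\|g_\xi\|$, where $$g_\xi(r)=-\frac{1}{a\sqrt{2\pi K(\xi)}}\int_0^\pi\frac{(\gamma r)^{\frac{a-1}{a}}\,\Gamma\left(-\frac{a-1}{a},\gamma r\right)}{1+\sqrt{\xi}\cos\theta}\,d\theta,\qquad \gamma=\frac12\,\frac{1-\sqrt{\xi}\cos\theta}{1+\sqrt{\xi}\cos\theta},$$ $K(\xi)=\int_0^{\pi/2}\frac{d\theta}{\sqrt{1-\xi^2\sin^2\theta}}$ is the complete elliptic integral of the first kind and $\Gamma(\zeta,x)=\int_x^{+\infty}e^{-t}t^{\zeta-1}\,dt$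 is the incomplete Gamma function. For the present statement these functions are taken with $a=\frac32$. *)

theory Defs
  imports "HOL-Analysis.Analysis"
begin

text \<open>
  Functions on \<open>(0, \<infinity>)\<close> are represented by total functions on the reals; only their values on
  the open set \<open>{0<..}\<close> matter below.
\<close>

definition L2norm :: "(real \<Rightarrow> real) \<Rightarrow> real" where
  "L2norm f = sqrt (LBINT r:{0<..}. (f r)\<^sup>2)"

text \<open>
  A non-integrable square has Bochner integral 0, so \<open>L2norm f = 1\<close> entails square integrability.
  Differentiability of \<open>(deriv ^^ k) f\<close> for \<open>k < 3\<close> gives the existence of \<open>f'\<close>, \<open>f''\<close>, \<open>f'''\<close>;
  no boundary conditions at 0 or infinity are imposed.
\<close>

definition normalized :: "(real \<Rightarrow> real) \<Rightarrow> bool" where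
  "normalized f \<longleftrightarrow>
     (\<forall>k<3. \<forall>r>0. ((deriv ^^ k) f) differentiable (at r)) \<and> L2norm f = 1"

text \<open>
  The functional takes values in \<^typ>\<open>ennreal\<close>: it is infinite when the integral diverges.
\<close>

definition Z6 :: "(real \<Rightarrow> real) \<Rightarrow> ennreal" where
  "Z6 f = ennreal (1 / 560) *
     (\<integral>\<^sup>+ r\<in>{0<..}. ennreal ((r * deriv f r + 9 * r ^ 2 * (deriv ^^ 2) f r
         + 9 / 2 * r ^ 3 * (deriv ^^ 3) f r)\<^sup>2) \<partial>lborel)"

definition ellipticK :: "real \<Rightarrow> real" where
  "ellipticK \<xi> = (LBINT \<theta>:{0..pi / 2}. 1 / sqrt (1 - \<xi>\<^sup>2 * (sin \<theta>)\<^sup>2))"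

text \<open>
  Unlike \<^const>\<open>Gamma\<close>, the upper incomplete Gamma function is used here also for \<open>\<zeta> \<le> 0\<close>, with \<open>x > 0\<close>.
\<close>

definition inc_Gamma :: "real \<Rightarrow> real \<Rightarrow> real" where
  "inc_Gamma \<zeta> x = (LBINT t:{x<..}. exp (- t) * t powr (\<zeta> - 1))"

definition gam :: "real \<Rightarrow> real \<Rightarrow> real" where
  "gam \<xi> \<theta> = 1 / 2 * ((1 - sqrt \<xi> * cos \<theta>) / (1 + sqrt \<xi> * cos \<theta>))"

definition g4 :: "real \<Rightarrow> real \<Rightarrow> real \<Rightarrow> real" where
  "g4 a \<xi> r = - (1 / (a * sqrt (2 * pi * ellipticK \<xi>))) *
     (LBINT \<theta>:{0..pi}. (gam \<xi> \<theta> * r) powr ((a - 1) / a)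
        * inc_Gamma (- ((a - 1) / a)) (gam \<xi> \<theta> * r) / (1 + sqrt \<xi> * cos \<theta>))"

definition f4 :: "real \<Rightarrow> real \<Rightarrow> real \<Rightarrow> real" where
  "f4 a \<xi> r = g4 a \<xi> r / L2norm (g4 a \<xi>)"

text \<open>
  The third-order operator factors as
  \<open>r f' + 9 r\<^sup>2 f'' + 9/2 r\<^sup>3 f''' = r F' + 3/2 r\<^sup>2 F''\<close> with \<open>F = 3 r f' - 2 f\<close>, and the four-partite
  functional with \<open>a = 3/2\<close> is the squared norm of the right-hand side. The function \<open>g6 \<xi>\<close> is the
  solution of \<open>3 r g' - 2 g = f4 (3/2) \<xi>\<close> that is square integrable on \<open>(0, \<infinity>)\<close>; it is unique,
  since the homogeneous solutions are the multiples of \<open>r powr (2/3)\<close>.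
\<close>

definition g6 :: "real \<Rightarrow> real \<Rightarrow> real" where
  "g6 \<xi> r = - (1 / 3) * r powr (2 / 3) *
     (LBINT t:{r<..}. t powr (- 5 / 3) * f4 (3 / 2) \<xi> t)"

definition f6 :: "real \<Rightarrow> real \<Rightarrow> real" where
  "f6 \<xi> r = g6 \<xi> r / L2norm (g6 \<xi>)"

end

theory Submission
  imports Defs "HOL-Real_Asymp.Real_Asymp"
begin

text \<open>
  With \<open>D = r d/dr\<close> the operator in \<^const>\<open>Z6\<close> is \<open>9/2 D (D - 1/3) (D - 2/3)\<close>. Each factor obeys a
  sharp Hardy inequality \<open>\<parallel>(D - c) G\<parallel> \<ge> (c + 1/2) \<parallel>G\<parallel>\<close> once the homogeneous solution \<open>r powr c\<close>
  has been split off, which gives the lower bound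
  \<open>1/560 (9/2 \<cdot> 1/2 \<cdot> 5/6 \<cdot> 7/6)\<^sup>2 = 35/4096\<close>; for \<open>f\<close> in \<open>L\<^sup>2\<close> the homogeneous parts must vanish.

  Up to a constant factor \<open>f6 \<xi>\<close> solves \<open>(D - 1/3) (D - 2/3) f = k\<close> with
  \<open>k(r) = \<integral> exp (- \<gamma>(\<theta>) r) / (1 + sqrt \<xi> cos \<theta>) d\<theta>\<close> over \<open>[0, \<pi>]\<close>. As \<open>\<xi> \<rightarrow> 1\<close> the function \<open>k\<close>
  approaches a multiple of \<open>r powr (- 1/2)\<close>, which \<open>E = D + 1/2\<close> annihilates: \<open>\<parallel>E k\<parallel>\<close> stays bounded while
  \<open>\<parallel>k\<parallel>\<close> grows like the square root of a logarithm. Since \<open>E\<close> commutes with all factors, all the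
  Hardy inequalities are asymptotically equalities along this family.
\<close>

section \<open>Square integrable functions on the half-line\<close>

text \<open>On L^2(dr) the Mellin transform turns \<open>D\<close> into multiplication by
  \<open>i t - 1/2\<close>. The symbol of \<open>D - c\<close> then has modulus at least
  \<open>c + 1/2\<close>, and every factor is smallest at the same frequency \<open>t = 0\<close>,
  so the three sharp constants multiply without loss. That frequency belongs to
  \<open>r powr (- 1/2)\<close>, which fails to be in L^2 at both ends. The obstacle in the lower
  bound is that only \<open>f\<close> and the full third-order expression are known to be square
  integrable, while nothing is known about the intermediate functions or about boundary values.
  Integrability is therefore carried from the third-order expression back to \<open>f\<close>; every
  inverted factor leaves an unknown multiple of a power of \<open>r\<close>, and these are removed
  together once \<open>f\<close> is reached. The obstacle for the family is uniformity in
  \<open>\<xi>\<close>: as \<open>\<xi>\<close> tends to 1, \<open>\<gamma>(\<theta>)\<close>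
  degenerates at both ends of [0, pi]. The bound on \<open>E k\<close> combines an integration by
  parts, which produces a factor \<open>1 - \<xi>\<close>, with a Cauchy-Schwarz inequality whose
  weight concentrates at these ends and has total mass pi for every \<open>\<xi>\<close>.\<close>

definition square_integrable :: "(real \<Rightarrow> real) \<Rightarrow> bool" where
  "square_integrable u \<longleftrightarrow>
     set_borel_measurable lborel {0<..} u \<and> set_integrable lborel {0<..} (\<lambda>r. (u r)\<^sup>2)"

lemma L2norm_nonneg [simp]: "0 \<le> L2norm u"
  by (simp add: L2norm_def set_lebesgue_integral_def)

lemma L2norm_power2: "(L2norm u)\<^sup>2 = (LBINT r:{0<..}. (u r)\<^sup>2)"
  by (simp add: L2norm_def set_lebesgue_integral_def)

lemma L2norm_cong: "(\<And>r. 0 < r \<Longrightarrow> u r = v r) \<Longrightarrow> L2norm u = L2norm v"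
  unfolding L2norm_def set_lebesgue_integral_def
  by (intro arg_cong[where f = sqrt] Bochner_Integration.integral_cong) (auto simp: indicator_def)

lemma L2norm_cmult: "L2norm (\<lambda>r. c * u r) = \<bar>c\<bar> * L2norm u"
proof -
  have "(LBINT r:{0<..}. (c * u r)\<^sup>2) = c\<^sup>2 * (LBINT r:{0<..}. (u r)\<^sup>2)"
    by (simp add: power_mult_distrib)
  then show ?thesis
    by (simp add: L2norm_def real_sqrt_mult)
qed

lemma square_integrable_cmult:
  "square_integrable u \<Longrightarrow> square_integrable (\<lambda>r. c * u r)"
  unfolding square_integrable_def set_borel_measurable_def
  by (auto simp: power_mult_distrib mult.left_commute)

text \<open>Integrability of the square says nothing about the sign of \<open>u\<close>, which is
  why measurability of \<open>u\<close> itself is carried along: it makes the cross term measurable.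
  Integrability then follows from domination by \<open>2 u^2 + 2 v^2\<close>.\<close>

lemma square_integrable_add:
  assumes "square_integrable u" "square_integrable v"
  shows "square_integrable (\<lambda>r. u r + v r)"
proof -
  have m: "set_borel_measurable lborel {0<..} (\<lambda>r. u r + v r)"
    using assms unfolding square_integrable_def set_borel_measurable_def
    by (auto simp: algebra_simps)
  have m2: "set_borel_measurable lborel {0<..} (\<lambda>r. (u r + v r)\<^sup>2)"
  proof -
    have "(\<lambda>r. (indicator {0<..} r *\<^sub>R (u r + v r))\<^sup>2) \<in> borel_measurable lborel"
      using m unfolding set_borel_measurable_def by measurable
    moreover have "(\<lambda>r. (indicator {0<..} r *\<^sub>R (u r + v r))\<^sup>2) =
        (\<lambda>r. indicator {0<..} r *\<^sub>R (u r + v r)\<^sup>2)"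
      by (auto simp: indicator_def)
    ultimately show ?thesis
      by (simp add: set_borel_measurable_def)
  qed
  have "set_integrable lborel {0<..} (\<lambda>r. 2 * (u r)\<^sup>2 + 2 * (v r)\<^sup>2)"
    using assms by (auto simp: square_integrable_def)
  then have "set_integrable lborel {0<..} (\<lambda>r. (u r + v r)\<^sup>2)"
  proof (rule set_integrable_bound[OF _ m2], intro AE_I2 impI)
    fix r
    have "(u r + v r)\<^sup>2 \<le> 2 * (u r)\<^sup>2 + 2 * (v r)\<^sup>2"
      using sum_squares_bound[of "u r" "v r"] by (simp add: power2_sum)
    then show "norm ((u r + v r)\<^sup>2) \<le> norm (2 * (u r)\<^sup>2 + 2 * (v r)\<^sup>2)"
      by simp
  qed
  then show ?thesis
    using m by (simp add: square_integrable_def)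
qed

lemma square_integrable_diff:
  "square_integrable u \<Longrightarrow> square_integrable v \<Longrightarrow> square_integrable (\<lambda>r. u r - v r)"
  using square_integrable_add[of u "\<lambda>r. - 1 * v r"] square_integrable_cmult[of v "-1"] by simp

text \<open>Young's inequality with a parameter \<open>t\<close> replaces the inner product; the
  choice \<open>t = b / a\<close> turns the right-hand side into \<open>(a + b)^2\<close>.\<close>

lemma L2norm_triangle:
  assumes "square_integrable u" "square_integrable v"
  shows "L2norm (\<lambda>r. u r + v r) \<le> L2norm u + L2norm v"
proof -
  define a b where "a = L2norm u" and "b = L2norm v"
  have ab: "0 \<le> a" "0 \<le> b"
    by (simp_all add: a_def b_def)
  have bound: "(L2norm (\<lambda>r. u r + v r))\<^sup>2 \<le> (1 + t) * a\<^sup>2 + (1 + 1 / t) * b\<^sup>2" if "0 < t" for t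
  proof -
    have "(L2norm (\<lambda>r. u r + v r))\<^sup>2
        \<le> (LBINT r:{0<..}. (1 + t) * (u r)\<^sup>2 + (1 + 1 / t) * (v r)\<^sup>2)"
      unfolding L2norm_power2
    proof (rule set_integral_mono)
      show "set_integrable lborel {0<..} (\<lambda>r. (u r + v r)\<^sup>2)"
        using square_integrable_add[OF assms] by (simp add: square_integrable_def)
      show "set_integrable lborel {0<..} (\<lambda>r. (1 + t) * (u r)\<^sup>2 + (1 + 1 / t) * (v r)\<^sup>2)"
        using assms by (auto simp: square_integrable_def)
      fix r
      have "(1 + t) * (u r)\<^sup>2 + (1 + 1 / t) * (v r)\<^sup>2 - (u r + v r)\<^sup>2 = (t * u r - v r)\<^sup>2 / t"
        using that by (simp add: field_simps power2_eq_square)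
      then show "(u r + v r)\<^sup>2 \<le> (1 + t) * (u r)\<^sup>2 + (1 + 1 / t) * (v r)\<^sup>2"
        using that by (smt (verit) divide_nonneg_pos zero_le_power2)
    qed
    also have "\<dots> = (1 + t) * a\<^sup>2 + (1 + 1 / t) * b\<^sup>2"
      using assms by (simp add: square_integrable_def a_def b_def L2norm_power2 set_integral_add)
    finally show ?thesis .
  qed
  have "L2norm (\<lambda>r. u r + v r) \<le> a + b"
  proof (rule field_le_epsilon)
    fix e :: real assume e: "0 < e"
    \<comment> \<open>Both norms are enlarged so that the optimal ratio \<open>b' / a'\<close> makes
      sense and is positive even if one of the norms is zero.\<close>
    define a' b' where "a' = a + e / 2" and "b' = b + e / 2"
    have p: "0 < a'" "0 < b'" "a \<le> a'" "b \<le> b'"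
      using ab e by (auto simp: a'_def b'_def)
    have "(L2norm (\<lambda>r. u r + v r))\<^sup>2 \<le> (1 + b' / a') * a\<^sup>2 + (1 + 1 / (b' / a')) * b\<^sup>2"
      using p by (intro bound) simp
    also have "\<dots> \<le> (1 + b' / a') * a'\<^sup>2 + (1 + 1 / (b' / a')) * b'\<^sup>2"
      using p ab by (intro add_mono mult_left_mono power_mono) auto
    also have "\<dots> = (a' + b')\<^sup>2"
      using p by (simp add: field_simps power2_eq_square)
    finally have "L2norm (\<lambda>r. u r + v r) \<le> a' + b'"
      by (rule power2_le_imp_le) (use p in auto)
    then show "L2norm (\<lambda>r. u r + v r) \<le> a + b + e"
      by (simp add: a'_def b'_def)
  qed
  then show ?thesis
    by (simp add: a_def b_def)
qed

lemma square_integrable_on_Icc: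
  assumes "square_integrable u" "0 < x"
  shows "(\<lambda>r. (u r)\<^sup>2) integrable_on {x..y}" "integral {x..y} (\<lambda>r. (u r)\<^sup>2) \<le> (L2norm u)\<^sup>2"
proof -
  have i: "set_integrable lborel {0<..} (\<lambda>r. (u r)\<^sup>2)"
    using assms by (simp add: square_integrable_def)
  then have i2: "set_integrable lborel {x..y} (\<lambda>r. (u r)\<^sup>2)"
    by (rule set_integrable_subset) (use assms in auto)
  show "(\<lambda>r. (u r)\<^sup>2) integrable_on {x..y}"
    by (rule set_borel_integral_eq_integral(1)[OF i2])
  show "integral {x..y} (\<lambda>r. (u r)\<^sup>2) \<le> (L2norm u)\<^sup>2"
    using assms(2) i i2
    unfolding L2norm_power2 set_borel_integral_eq_integral(2)[OF i2, symmetric]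
      set_lebesgue_integral_def set_integrable_def
    by (intro integral_mono) (auto simp: indicator_def)
qed

text \<open>Monotone convergence along an exhaustion by compact intervals. It is the bridge from
  gauge integrals over compact intervals, where the fundamental theorem of calculus is applied, to
  Lebesgue integrals over the half-line.\<close>

lemma square_integrable_continuous_bounded:
  assumes cont: "continuous_on {0<..} u"
    and bd: "\<And>x y. 0 < x \<Longrightarrow> x < y \<Longrightarrow> integral {x..y} (\<lambda>r. (u r)\<^sup>2) \<le> B"
  shows "square_integrable u" "(L2norm u)\<^sup>2 \<le> B"
proof -
  \<comment> \<open>The shift by 2 makes every interval nondegenerate, since \<open>bd\<close> asks
    for \<open>x < y\<close>; a shift by 1 would give a single point at
    \<open>n = 0\<close>.\<close>
  define S where "S n = {1 / real (n + 2)..real (n + 2)}" for n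
  define f where "f n r = indicator (S n) r * (u r)\<^sup>2" for n r
  have Spos: "S n \<subseteq> {0<..}" for n
  proof
    fix r assume "r \<in> S n"
    then have "1 / real (n + 2) \<le> r"
      by (simp add: S_def)
    moreover have "0 < 1 / real (n + 2)"
      by simp
    ultimately show "r \<in> {0<..}"
      by (simp only: greaterThan_iff)
  qed
  have cS: "continuous_on (S n) (\<lambda>r. (u r)\<^sup>2)" for n
    using continuous_on_subset[OF cont Spos] by (intro continuous_intros)
  have iS: "set_integrable lborel (S n) (\<lambda>r. (u r)\<^sup>2)" for n
    using cS[of n] unfolding S_def by (rule borel_integrable_atLeastAtMost')
  have int_f: "integrable lborel (f n)" for n
    using iS[of n] by (simp add: set_integrable_def f_def[abs_def])
  have Lf: "integral\<^sup>L lborel (f n) \<le> B" for n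
  proof -
    have "integral\<^sup>L lborel (f n) = integral (S n) (\<lambda>r. (u r)\<^sup>2)"
      using set_borel_integral_eq_integral(2)[OF iS[of n]]
      by (simp add: set_lebesgue_integral_def f_def[abs_def])
    also have "\<dots> \<le> B"
      unfolding S_def
    proof (rule bd)
      have "1 / real (n + 2) < 1" by simp
      also have "1 < real (n + 2)" by simp
      finally show "1 / real (n + 2) < real (n + 2)" .
    qed simp
    finally show ?thesis .
  qed
  have Sinc: "S m \<subseteq> S n" if "m \<le> n" for m n
    using that unfolding S_def by (intro atLeastatMost_subset_iff[THEN iffD2] disjI2 conjI) (auto intro: frac_le)
  have mono: "mono (\<lambda>n. f n r)" for r
    using Sinc by (auto simp: mono_def f_def indicator_def)
  have lim: "(\<lambda>n. f n r) \<longlonglongrightarrow> indicator {0<..} r * (u r)\<^sup>2" for r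
  proof (cases "0 < r")
    case True
    have "eventually (\<lambda>n. r < real (n + 2) \<and> 1 / real (n + 2) < r) sequentially"
      using True by (intro eventually_conj; real_asymp)
    then have "eventually (\<lambda>n. f n r = indicator {0<..} r * (u r)\<^sup>2) sequentially"
      by (rule eventually_mono) (use True in \<open>auto simp: f_def S_def\<close>)
    then show ?thesis
      by (rule tendsto_eventually)
  next
    case False
    then have "f n r = 0" for n
      using Spos[of n] by (auto simp: f_def indicator_def)
    then show ?thesis
      using False by simp
  qed
  have inc: "incseq (\<lambda>n. integral\<^sup>L lborel (f n))"
    by (intro incseq_SucI integral_mono int_f) (use mono in \<open>auto simp: mono_def\<close>)
  then obtain L where L: "(\<lambda>n. integral\<^sup>L lborel (f n)) \<longlonglongrightarrow> L"
    using incseq_convergent[of _ B] Lf by blast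
  have meas: "set_borel_measurable lborel {0<..} u"
    using set_measurable_continuous_on[OF _ cont] by (simp add: set_borel_measurable_def)
  have meas2: "(\<lambda>r. indicator {0<..} r * (u r)\<^sup>2) \<in> borel_measurable lborel"
    using set_measurable_continuous_on[of "{0<..}" "\<lambda>r. (u r)\<^sup>2"] cont
    by (simp add: set_borel_measurable_def continuous_intros)
  have h: "has_bochner_integral lborel (\<lambda>r. indicator {0<..} r * (u r)\<^sup>2) L"
    using has_bochner_integral_monotone_convergence[OF int_f _ _ L meas2] mono lim by auto
  show "square_integrable u"
    using h meas by (simp add: square_integrable_def set_integrable_def has_bochner_integral_iff)
  have "L \<le> B"
    using L Lf by (intro LIMSEQ_le_const2) auto
  then show "(L2norm u)\<^sup>2 \<le> B"
    using h by (simp add: L2norm_power2 set_lebesgue_integral_def has_bochner_integral_iff)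
qed

section \<open>Tail integrals and exponential majorants\<close>

lemma set_integral_tail_split:
  fixes f :: "real \<Rightarrow> real"
  assumes f: "set_integrable lborel {a<..} f" and x: "a \<le> x"
  shows "(LBINT t:{a<..}. f t) = (LBINT t:{a<..x}. f t) + (LBINT t:{x<..}. f t)"
proof -
  have "{a<..} = {a<..x} \<union> {x<..}" "{a<..x} \<inter> {x<..} = {}"
    using x by auto
  moreover have "set_integrable lborel {a<..x} f" "set_integrable lborel {x<..} f"
    using x by (auto intro: set_integrable_subset[OF f])
  ultimately show ?thesis
    by (simp add: set_integral_Un)
qed

lemma set_integral_tail_eq:
  fixes f :: "real \<Rightarrow> real"
  assumes f: "set_integrable lborel {a<..} f" and x: "a \<le> x"
  shows "(LBINT t:{x<..}. f t) = (LBINT t:{a<..}. f t) - integral {a..x} f"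
proof -
  have "set_integrable lborel {a<..x} f"
    by (rule set_integrable_subset[OF f]) auto
  then have "(LBINT t:{a<..x}. f t) = integral {a<..x} f"
    by (rule set_borel_integral_eq_integral(2))
  also have "integral {a<..x} f = integral {a..x} f"
    by (rule integral_spike_set) (auto intro: negligible_subset[of "{a}"])
  finally show ?thesis
    using set_integral_tail_split[OF assms] by simp
qed

lemma set_integral_tail_tendsto_0:
  fixes f :: "real \<Rightarrow> real"
  assumes f: "set_integrable lborel {a<..} f"
  shows "((\<lambda>x. LBINT t:{x<..}. f t) \<longlongrightarrow> 0) at_top"
proof -
  have i: "integrable lborel (\<lambda>t. indicator {a<..} t *\<^sub>R f t)"
    using f by (simp add: set_integrable_def)
  have "((\<lambda>x. (LBINT t:{a<..}. f t) - (\<integral>t. indicator {..x} t *\<^sub>R (indicator {a<..} t *\<^sub>R f t) \<partial>lborel))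
      \<longlongrightarrow> (LBINT t:{a<..}. f t) - (LBINT t:{a<..}. f t)) at_top"
    unfolding set_lebesgue_integral_def
    by (intro tendsto_diff tendsto_const tendsto_integral_at_top[OF _ i]) simp
  then have "((\<lambda>x. (LBINT t:{a<..}. f t) - (\<integral>t. indicator {..x} t *\<^sub>R (indicator {a<..} t *\<^sub>R f t) \<partial>lborel))
      \<longlongrightarrow> 0) at_top"
    by simp
  then show ?thesis
  proof (rule Lim_transform_eventually, intro eventually_mono[OF eventually_ge_at_top[of a]])
    fix x assume x: "a \<le> x"
    have "(\<integral>t. indicator {..x} t *\<^sub>R (indicator {a<..} t *\<^sub>R f t) \<partial>lborel) = (LBINT t:{a<..x}. f t)"
      unfolding set_lebesgue_integral_def
      by (intro Bochner_Integration.integral_cong) (auto simp: indicator_def)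
    then show "(LBINT t:{a<..}. f t) -
        (\<integral>t. indicator {..x} t *\<^sub>R (indicator {a<..} t *\<^sub>R f t) \<partial>lborel) = (LBINT t:{x<..}. f t)"
      using set_integral_tail_split[OF f x] by simp
  qed
qed

lemma has_real_derivative_set_integral_tail:
  fixes f :: "real \<Rightarrow> real"
  assumes cont: "continuous_on {0<..} f"
    and f: "\<And>x. 0 < x \<Longrightarrow> set_integrable lborel {x<..} f" and x: "0 < x"
  shows "((\<lambda>x. LBINT t:{x<..}. f t) has_real_derivative - f x) (at x)"
proof -
  \<comment> \<open>With a base point strictly between 0 and \<open>x\<close>, the tail from
    \<open>a\<close> is a constant and \<open>x\<close> lies in the interior of the interval of
    integration.\<close>
  define a where "a = x / 2"
  have a: "0 < a" "a < x"
    using x by (auto simp: a_def)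
  have "((\<lambda>x. integral {a..x} f) has_real_derivative f x) (at x within {a..x + 1})"
    using a by (intro integral_has_real_derivative continuous_on_subset[OF cont]) auto
  moreover have "at x within {a..x + 1} = at x"
    using a by (intro at_within_interior) auto
  ultimately have "((\<lambda>x. (LBINT t:{a<..}. f t) - integral {a..x} f) has_real_derivative 0 - f x) (at x)"
    by (intro DERIV_diff DERIV_const) simp
  then have "((\<lambda>x. LBINT t:{x<..}. f t) has_real_derivative 0 - f x) (at x)"
    by (rule has_field_derivative_transform_within_open[of _ _ _ "{a<..}"])
      (use a in \<open>auto intro!: set_integral_tail_eq[symmetric] f\<close>)
  then show ?thesis
    by simp
qed

text \<open>The exponential is the square of \<open>exp (- (l / 2 * t))\<close>, so the criterion by
  bounded integrals over compact intervals applies to it.\<close>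

lemma set_integrable_exp_minus:
  assumes l: "0 < l"
  shows "set_integrable lborel {0<..} (\<lambda>t::real. exp (- (l * t)))"
proof -
  have eq: "(exp (- (l / 2 * t)))\<^sup>2 = exp (- (l * t))" for t :: real
    by (simp add: power2_eq_square exp_add[symmetric])
  have "integral {x..y} (\<lambda>t. (exp (- (l / 2 * t)))\<^sup>2) \<le> 1 / l" if xy: "0 < x" "x < y" for x y :: real
  proof -
    have "((\<lambda>t. exp (- (l * t))) has_integral (- exp (- (l * y)) / l - - exp (- (l * x)) / l)) {x..y}"
      using l xy by (intro fundamental_theorem_of_calculus)
        (auto intro!: derivative_eq_intros simp flip: has_real_derivative_iff_has_vector_derivative)
    then have "integral {x..y} (\<lambda>t. (exp (- (l / 2 * t)))\<^sup>2) = - exp (- (l * y)) / l - - exp (- (l * x)) / l"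
      unfolding eq by (rule integral_unique)
    also have "\<dots> \<le> 1 / l"
    proof -
      have "exp (- (l * x)) \<le> 1" "0 < exp (- (l * y))"
        using l xy by auto
      then have "(- exp (- (l * y)) + exp (- (l * x))) / l \<le> 1 / l"
        using l by (intro divide_right_mono) linarith+
      then show ?thesis
        by (simp add: add_divide_distrib diff_divide_distrib)
    qed
    finally show ?thesis .
  qed
  then have "square_integrable (\<lambda>t. exp (- (l / 2 * t)))"
    by (intro square_integrable_continuous_bounded(1) continuous_intros)
  then show ?thesis
    unfolding square_integrable_def eq by simp
qed

lemma set_integrable_exp_bounded:
  fixes f :: "real \<Rightarrow> real"
  assumes cont: "continuous_on {0<..} f" and l: "0 < l" and x: "0 \<le> x"
    and bd: "\<And>t. x < t \<Longrightarrow> \<bar>f t\<bar> \<le> A * exp (- (l * t))"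
  shows "set_integrable lborel {x<..} f"
proof -
  have "set_integrable lborel {0<..} (\<lambda>t. A * exp (- (l * t)))"
    using set_integrable_exp_minus[OF l] by simp
  then have "set_integrable lborel {x<..} (\<lambda>t. A * exp (- (l * t)))"
    by (rule set_integrable_subset) (use x in auto)
  then show ?thesis
  proof (rule set_integrable_bound)
    have "continuous_on {x<..} f"
      by (rule continuous_on_subset[OF cont]) (use x in auto)
    then show "set_borel_measurable lborel {x<..} f"
      using set_measurable_continuous_on[of "{x<..}" f] by (simp add: set_borel_measurable_def)
    show "AE t in lborel. t \<in> {x<..} \<longrightarrow> norm (f t) \<le> norm (A * exp (- (l * t)))"
      using bd by (auto intro!: AE_I2 order_trans[OF _ abs_ge_self])
  qed
qed

section \<open>Hardy's inequality for Euler operators\<close>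

text \<open>This is \<open>(D - c) G = u\<close> with \<open>D = r d/dr\<close>. Stated as a
  relation it includes the differentiability of \<open>G\<close> and lets \<open>u\<close> be
  discontinuous, as a third derivative may be.\<close>

definition euler_ode :: "real \<Rightarrow> (real \<Rightarrow> real) \<Rightarrow> (real \<Rightarrow> real) \<Rightarrow> bool" where
  "euler_ode c G u \<longleftrightarrow> (\<forall>r>0. (G has_real_derivative (c * G r + u r) / r) (at r))"

lemma euler_odeD:
  "euler_ode c G u \<Longrightarrow> 0 < r \<Longrightarrow> (G has_real_derivative (c * G r + u r) / r) (at r)"
  by (simp add: euler_ode_def)

lemma euler_ode_continuous_on: "euler_ode c G u \<Longrightarrow> continuous_on {0<..} G"
  by (intro continuous_at_imp_continuous_on ballI DERIV_isCont) (auto simp: euler_ode_def)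

lemma euler_ode_diff_powr:
  assumes "euler_ode c G u"
  shows "euler_ode c (\<lambda>r. G r - \<gamma> * r powr c) u"
  unfolding euler_ode_def
proof (intro allI impI)
  fix r :: real assume r: "0 < r"
  have "((\<lambda>r. G r - \<gamma> * r powr c) has_real_derivative
      (c * G r + u r) / r - \<gamma> * (c * r powr (c - 1))) (at r)"
    using r by (auto intro!: derivative_eq_intros euler_odeD[OF assms])
  also have "(c * G r + u r) / r - \<gamma> * (c * r powr (c - 1)) = (c * (G r - \<gamma> * r powr c) + u r) / r"
    using r by (simp add: powr_diff field_simps)
  finally show "((\<lambda>r. G r - \<gamma> * r powr c) has_real_derivative
      (c * (G r - \<gamma> * r powr c) + u r) / r) (at r)" .
qed

section \<open>Behaviour of solutions at infinity and Hardy's inequality\<close>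

definition L2tail :: "(real \<Rightarrow> real) \<Rightarrow> real \<Rightarrow> real" where
  "L2tail u x = (LBINT r:{x<..}. (u r)\<^sup>2)"

lemma L2tail_tendsto_0:
  "square_integrable u \<Longrightarrow> (L2tail u \<longlongrightarrow> 0) at_top"
  unfolding L2tail_def[abs_def] square_integrable_def
  by (blast intro: set_integral_tail_tendsto_0)

lemma L2tail_nonneg [simp]: "0 \<le> L2tail u x"
  by (simp add: L2tail_def set_lebesgue_integral_def)

lemma integral_le_L2tail:
  assumes "square_integrable u" "0 < x" "x \<le> y"
  shows "integral {x..y} (\<lambda>r. (u r)\<^sup>2) \<le> L2tail u x"
proof -
  have "set_integrable lborel {0<..} (\<lambda>r. (u r)\<^sup>2)"
    using assms by (simp add: square_integrable_def)
  then have "set_integrable lborel {x<..} (\<lambda>r. (u r)\<^sup>2)"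
    by (rule set_integrable_subset) (use assms in auto)
  from set_integral_tail_eq[OF this assms(3)] show ?thesis
    using L2tail_nonneg[of u y] by (simp add: L2tail_def)
qed

text \<open>The scaled function has derivative \<open>r powr (- c - 1) * u r\<close>, and Young's
  inequality with weight \<open>l\<close> separates the two factors. The condition on
  \<open>c\<close> makes \<open>r powr (- 2 * c - 2)\<close> integrable at infinity. The weight
  stays free: it is 1 for the existence of the limit and depends on \<open>x\<close> for the decay
  rate.\<close>

lemma euler_ode_scaled_increment:
  assumes ode: "euler_ode c G u" and sq: "square_integrable u"
    and c: "- 1 / 2 < c" and l: "0 < l" and xy: "0 < x" "x \<le> y"
  shows "\<bar>G y * y powr (- c) - G x * x powr (- c)\<bar>
    \<le> l / 2 * (x powr (- 2 * c - 1) / (2 * c + 1)) + L2tail u x / (2 * l)"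
proof -
  have pos: "0 < r" if "r \<in> {x..y}" for r
    using that xy by auto
  have v: "((\<lambda>r. r powr (- c - 1) * u r) has_integral (G y * y powr (- c) - G x * x powr (- c))) {x..y}"
  proof (rule fundamental_theorem_of_calculus[OF xy(2)])
    fix r assume r: "r \<in> {x..y}"
    have "((\<lambda>r. G r * r powr (- c)) has_real_derivative
        (c * G r + u r) / r * r powr (- c) + G r * (- c * r powr (- c - 1))) (at r)"
      using pos[OF r] by (auto intro!: derivative_eq_intros euler_odeD[OF ode])
    also have "(c * G r + u r) / r * r powr (- c) + G r * (- c * r powr (- c - 1)) = r powr (- c - 1) * u r"
      using pos[OF r] by (simp add: powr_diff field_simps)
    finally show "((\<lambda>r. G r * r powr (- c)) has_vector_derivative r powr (- c - 1) * u r) (at r within {x..y})"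
      by (simp add: has_real_derivative_iff_has_vector_derivative has_vector_derivative_at_within)
  qed
  have p: "((\<lambda>r. r powr (- 2 * c - 2)) has_integral
      (- (y powr (- 2 * c - 1) / (2 * c + 1)) - - (x powr (- 2 * c - 1) / (2 * c + 1)))) {x..y}"
  proof (rule fundamental_theorem_of_calculus[OF xy(2)])
    fix r assume r: "r \<in> {x..y}"
    have "((\<lambda>r. - (r powr (- 2 * c - 1) / (2 * c + 1))) has_real_derivative
        - ((- 2 * c - 1) * r powr (- 2 * c - 1 - 1) / (2 * c + 1))) (at r)"
      using pos[OF r] c by (auto intro!: derivative_eq_intros)
    also have "- ((- 2 * c - 1) * r powr (- 2 * c - 1 - 1) / (2 * c + 1)) = r powr (- 2 * c - 2)"
      using c by (simp add: field_simps)
    finally show "((\<lambda>r. - (r powr (- 2 * c - 1) / (2 * c + 1))) has_vector_derivative r powr (- 2 * c - 2)) (at r within {x..y})"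
      by (simp add: has_real_derivative_iff_has_vector_derivative has_vector_derivative_at_within)
  qed
  have u2: "((\<lambda>r. (u r)\<^sup>2) has_integral integral {x..y} (\<lambda>r. (u r)\<^sup>2)) {x..y}"
    using square_integrable_on_Icc(1)[OF sq xy(1)] by (rule integrable_integral)
  have b: "((\<lambda>r. l / 2 * r powr (- 2 * c - 2) + (u r)\<^sup>2 / (2 * l)) has_integral
      (l / 2 * (- (y powr (- 2 * c - 1) / (2 * c + 1)) - - (x powr (- 2 * c - 1) / (2 * c + 1)))
       + integral {x..y} (\<lambda>r. (u r)\<^sup>2) / (2 * l))) {x..y}"
    by (intro has_integral_add has_integral_mult_right p has_integral_divide u2)
  have "norm (G y * y powr (- c) - G x * x powr (- c)) =
      norm (integral {x..y} (\<lambda>r. r powr (- c - 1) * u r))"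
    using v by (simp add: integral_unique)
  also have "\<dots> \<le> integral {x..y} (\<lambda>r. l / 2 * r powr (- 2 * c - 2) + (u r)\<^sup>2 / (2 * l))"
  proof (rule integral_norm_bound_integral)
    fix r assume r: "r \<in> {x..y}"
    define a where "a = r powr (- c - 1)"
    have a2: "r powr (- 2 * c - 2) = a\<^sup>2"
      using pos[OF r] by (simp add: a_def power2_eq_square powr_add[symmetric])
    have "l / 2 * a\<^sup>2 + (u r)\<^sup>2 / (2 * l) - \<bar>a * u r\<bar> = (l * \<bar>a\<bar> - \<bar>u r\<bar>)\<^sup>2 / (2 * l)"
      using l by (simp add: field_simps power2_eq_square abs_mult)
    then have "0 \<le> l / 2 * a\<^sup>2 + (u r)\<^sup>2 / (2 * l) - \<bar>a * u r\<bar>"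
      using l by simp
    then show "norm (r powr (- c - 1) * u r) \<le> l / 2 * r powr (- 2 * c - 2) + (u r)\<^sup>2 / (2 * l)"
      unfolding a2 by (simp add: a_def)
  qed (use v b in \<open>auto simp: integrable_on_def\<close>)
  also have "\<dots> = l / 2 * (- (y powr (- 2 * c - 1) / (2 * c + 1)) - - (x powr (- 2 * c - 1) / (2 * c + 1)))
       + integral {x..y} (\<lambda>r. (u r)\<^sup>2) / (2 * l)"
    using b by (rule integral_unique)
  also have "\<dots> \<le> l / 2 * (x powr (- 2 * c - 1) / (2 * c + 1)) + L2tail u x / (2 * l)"
    using l c integral_le_L2tail[OF sq xy]
    by (intro add_mono mult_left_mono divide_right_mono) auto
  finally show ?thesis
    by simp
qed

text \<open>The increment bound tends to 0, which is a Cauchy condition at infinity. The limit is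
  the coefficient of the homogeneous solution \<open>r powr c\<close> contained in
  \<open>G\<close>.\<close>

lemma euler_ode_scaled_limit:
  assumes ode: "euler_ode c G u" and sq: "square_integrable u" and c: "- 1 / 2 < c"
  obtains \<gamma> where "((\<lambda>r. G r * r powr (- c)) \<longlongrightarrow> \<gamma>) at_top"
proof -
  define v where "v r = G r * r powr (- c)" for r
  define b where "b x = 1 / 2 * (x powr (- 2 * c - 1) / (2 * c + 1)) + L2tail u x / 2" for x
  have vb: "\<bar>v y - v x\<bar> \<le> b x" if "0 < x" "x \<le> y" for x y
    using euler_ode_scaled_increment[OF ode sq c zero_less_one that] by (simp add: v_def b_def)
  have "((\<lambda>x. 1 / 2 * (x powr (- 2 * c - 1) / (2 * c + 1)) + L2tail u x / 2) \<longlongrightarrow>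
      1 / 2 * (0 / (2 * c + 1)) + 0 / 2) at_top"
    using c by (intro tendsto_intros L2tail_tendsto_0[OF sq] tendsto_neg_powr filterlim_ident) auto
  then have b0: "(b \<longlongrightarrow> 0) at_top"
    by (simp add: b_def[abs_def])
  have "Cauchy (\<lambda>n. v (real n))"
  proof (rule metric_CauchyI)
    fix e :: real assume "0 < e"
    then have "eventually (\<lambda>x. b x < e / 2) at_top"
      using b0 by (intro order_tendstoD) auto
    then obtain x0 where x0: "\<And>x. x0 \<le> x \<Longrightarrow> b x < e / 2"
      by (auto simp: eventually_at_top_linorder)
    define N where "N = nat \<lceil>max x0 1\<rceil>"
    have N: "x0 \<le> real N" "0 < real N"
      unfolding N_def by linarith+
    have "\<bar>v (real n) - v (real N)\<bar> < e / 2" if "N \<le> n" for n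
      using vb[of "real N" "real n"] x0[of "real N"] N that by auto
    then show "\<exists>M. \<forall>m\<ge>M. \<forall>n\<ge>M. dist (v (real m)) (v (real n)) < e"
      by (intro exI[of _ N]) (smt (verit) dist_real_def field_sum_of_halves)
  qed
  then obtain \<gamma> where g: "(\<lambda>n. v (real n)) \<longlonglongrightarrow> \<gamma>"
    using Cauchy_convergent_iff convergent_def by blast
  have "\<bar>v x - \<gamma>\<bar> \<le> b x" if "0 < x" for x
  proof (rule LIMSEQ_le_const2)
    show "(\<lambda>n. \<bar>v x - v (real n)\<bar>) \<longlonglongrightarrow> \<bar>v x - \<gamma>\<bar>"
      by (intro tendsto_intros g)
    show "\<exists>N. \<forall>n\<ge>N. \<bar>v x - v (real n)\<bar> \<le> b x"
    proof (intro exI[of _ "nat \<lceil>x\<rceil>"] allI impI)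
      fix n assume "nat \<lceil>x\<rceil> \<le> n"
      then have "x \<le> real n" by linarith
      then show "\<bar>v x - v (real n)\<bar> \<le> b x"
        using vb[OF that, of "real n"] by (simp add: abs_minus_commute)
    qed
  qed
  then have "eventually (\<lambda>x. norm (v x - \<gamma>) \<le> b x) at_top"
    by (intro eventually_mono[OF eventually_gt_at_top[of 0]]) simp
  then have "((\<lambda>x. v x - \<gamma>) \<longlongrightarrow> 0) at_top"
    using b0 by (rule Lim_null_comparison)
  then have "(v \<longlongrightarrow> \<gamma>) at_top"
    by (simp add: LIM_zero_iff)
  with that show thesis
    by (simp add: v_def[abs_def])
qed

text \<open>Letting \<open>y\<close> tend to infinity in the increment bound estimates
  \<open>G x\<close> itself; a weight \<open>l\<close> adapted to \<open>x\<close> gives both terms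
  the order of the root of the tail of \<open>u\<close>.\<close>

lemma euler_ode_decay:
  assumes ode: "euler_ode c G u" and sq: "square_integrable u" and c: "- 1 / 2 < c"
    and lim: "((\<lambda>r. G r * r powr (- c)) \<longlongrightarrow> 0) at_top"
  shows "((\<lambda>r. r * (G r)\<^sup>2) \<longlongrightarrow> 0) at_top"
proof -
  define A where "A = 1 / (2 * (2 * c + 1)) + 1 / 2"
  \<comment> \<open>The summand \<open>1 / x\<close> keeps \<open>\<eta> x\<close> positive where
    the tail of \<open>u\<close> vanishes, so that division by \<open>\<eta> x\<close> is
    legitimate.\<close>
  define \<eta> where "\<eta> x = sqrt (L2tail u x + 1 / x)" for x
  have bd: "sqrt x * \<bar>G x\<bar> \<le> A * \<eta> x" if x: "0 < x" for x
  proof -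
    have p: "0 < L2tail u x + 1 / x" "L2tail u x \<le> (\<eta> x)\<^sup>2" "0 < \<eta> x"
      using L2tail_nonneg[of u x] x by (auto simp: \<eta>_def add_nonneg_pos)
    define l where "l = \<eta> x * x powr (c + 1 / 2)"
    have l: "0 < l"
      using p x by (simp add: l_def)
    have "\<bar>0 - G x * x powr (- c)\<bar> \<le> l / 2 * (x powr (- 2 * c - 1) / (2 * c + 1)) + L2tail u x / (2 * l)"
    proof (rule tendsto_upperbound[OF _ _ trivial_limit_at_top_linorder])
      show "((\<lambda>y. \<bar>G y * y powr (- c) - G x * x powr (- c)\<bar>) \<longlongrightarrow> \<bar>0 - G x * x powr (- c)\<bar>) at_top"
        by (intro tendsto_intros lim)
      show "\<forall>\<^sub>F y in at_top. \<bar>G y * y powr (- c) - G x * x powr (- c)\<bar>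
          \<le> l / 2 * (x powr (- 2 * c - 1) / (2 * c + 1)) + L2tail u x / (2 * l)"
        using eventually_ge_at_top[of x]
        by eventually_elim (rule euler_ode_scaled_increment[OF ode sq c l x])
    qed
    then have "\<bar>G x\<bar> * x powr (- c) * x powr (c + 1 / 2) \<le>
        (l / 2 * (x powr (- 2 * c - 1) / (2 * c + 1)) + L2tail u x / (2 * l)) * x powr (c + 1 / 2)"
      by (intro mult_right_mono) (auto simp: abs_mult)
    also have "\<bar>G x\<bar> * x powr (- c) * x powr (c + 1 / 2) = sqrt x * \<bar>G x\<bar>"
      using x by (simp add: mult.assoc powr_add[symmetric] powr_half_sqrt)
    also have "(l / 2 * (x powr (- 2 * c - 1) / (2 * c + 1)) + L2tail u x / (2 * l)) * x powr (c + 1 / 2)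
        = \<eta> x / (2 * (2 * c + 1)) + L2tail u x / (2 * \<eta> x)"
    proof -
      define P Q d where "P = x powr (c + 1 / 2)" and "Q = x powr (- 2 * c - 1)" and "d = 2 * c + 1"
      have PQ: "Q * P * P = 1" and P: "P \<noteq> 0" and d: "d \<noteq> 0"
        using x c by (simp_all add: P_def Q_def d_def powr_add[symmetric])
      have "(\<eta> x * P / 2 * (Q / d) + L2tail u x / (2 * (\<eta> x * P))) * P
          = \<eta> x * (Q * P * P) / (2 * d) + L2tail u x / (2 * \<eta> x)"
        using P d p(3) by (simp add: field_simps)
      then show ?thesis
        unfolding PQ by (simp add: l_def P_def Q_def d_def)
    qed
    also have "L2tail u x / (2 * \<eta> x) \<le> (\<eta> x)\<^sup>2 / (2 * \<eta> x)"
      using p by (intro divide_right_mono) auto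
    also have "\<eta> x / (2 * (2 * c + 1)) + (\<eta> x)\<^sup>2 / (2 * \<eta> x) = A * \<eta> x"
      using p c by (simp add: A_def field_simps power2_eq_square)
    finally show ?thesis
      by simp
  qed
  have "((\<lambda>x. sqrt (L2tail u x + 1 / x)) \<longlongrightarrow> sqrt (0 + 0)) at_top"
    by (intro tendsto_intros L2tail_tendsto_0[OF sq]) real_asymp
  then have "((\<lambda>x. A * \<eta> x) \<longlongrightarrow> A * 0) at_top"
    unfolding \<eta>_def[abs_def] by (intro tendsto_intros) simp
  then have "((\<lambda>x. sqrt x * \<bar>G x\<bar>) \<longlongrightarrow> 0) at_top"
    by (intro Lim_null_comparison[of "\<lambda>x. sqrt x * \<bar>G x\<bar>" "\<lambda>x. A * \<eta> x"]
          eventually_mono[OF eventually_gt_at_top[of 0]])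
       (auto simp: abs_mult bd)
  then have "((\<lambda>x. (sqrt x * \<bar>G x\<bar>)\<^sup>2) \<longlongrightarrow> 0\<^sup>2) at_top"
    by (rule tendsto_power)
  then have "((\<lambda>x. (sqrt x * \<bar>G x\<bar>)\<^sup>2) \<longlongrightarrow> 0) at_top"
    by simp
  then show ?thesis
    by (rule Lim_transform_eventually)
       (intro eventually_mono[OF eventually_gt_at_top[of 0]], simp add: power_mult_distrib)
qed

text \<open>Integrate \<open>(r G^2)' = 2 a G^2 + 2 G u\<close> with \<open>a = c + 1/2\<close>.
  Square integrability of \<open>G\<close> is part of the conclusion, so the estimate is made on
  compact intervals with a bound that does not depend on them.\<close>

theorem hardy_inequality:
  assumes ode: "euler_ode c G u" and sq: "square_integrable u" and c: "- 1 / 2 < c"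
    and lim: "((\<lambda>r. G r * r powr (- c)) \<longlongrightarrow> 0) at_top"
  shows "square_integrable G" "(c + 1 / 2) * L2norm G \<le> L2norm u"
proof -
  define a where "a = c + 1 / 2"
  have a: "0 < a" "c = a - 1 / 2"
    using c by (auto simp: a_def)
  define B where "B = (L2norm u)\<^sup>2 / a\<^sup>2"
  have cont: "continuous_on {0<..} G"
    by (rule euler_ode_continuous_on[OF ode])
  have cont2: "continuous_on {x..y} (\<lambda>r. (G r)\<^sup>2)" if "0 < x" for x y
    using that by (intro continuous_intros continuous_on_subset[OF cont]) auto
  have int_G2: "(\<lambda>r. (G r)\<^sup>2) integrable_on {x..y}" if "0 < x" for x y
    using cont2[OF that] by (rule integrable_continuous_real)
  have bd: "integral {x..y} (\<lambda>r. (G r)\<^sup>2) \<le> y * (G y)\<^sup>2 / a + B" if xy: "0 < x" "x \<le> y" for x y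
  proof -
    have pos: "0 < r" if "r \<in> {x..y}" for r
      using that xy by auto
    have w: "((\<lambda>r. 2 * a * (G r)\<^sup>2 + 2 * G r * u r) has_integral (y * (G y)\<^sup>2 - x * (G x)\<^sup>2)) {x..y}"
    proof (rule fundamental_theorem_of_calculus[OF xy(2)])
      fix r assume r: "r \<in> {x..y}"
      have "((\<lambda>r. r * (G r)\<^sup>2) has_real_derivative
          (G r)\<^sup>2 + r * (2 * G r * ((c * G r + u r) / r))) (at r)"
        using pos[OF r] by (auto intro!: derivative_eq_intros euler_odeD[OF ode])
      also have "(G r)\<^sup>2 + r * (2 * G r * ((c * G r + u r) / r)) = 2 * a * (G r)\<^sup>2 + 2 * G r * u r"
        using pos[OF r] by (simp add: a(2) field_simps power2_eq_square)
      finally show "((\<lambda>r. r * (G r)\<^sup>2) has_vector_derivative 2 * a * (G r)\<^sup>2 + 2 * G r * u r) (at r within {x..y})"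
        by (simp add: has_real_derivative_iff_has_vector_derivative has_vector_derivative_at_within)
    qed
    have l: "((\<lambda>r. a * (G r)\<^sup>2 - (u r)\<^sup>2 / a) has_integral
        (a * integral {x..y} (\<lambda>r. (G r)\<^sup>2) - integral {x..y} (\<lambda>r. (u r)\<^sup>2) / a)) {x..y}"
      using int_G2[OF xy(1)] square_integrable_on_Icc(1)[OF sq xy(1)]
      by (intro has_integral_diff has_integral_mult_right has_integral_divide integrable_integral)
    have "a * integral {x..y} (\<lambda>r. (G r)\<^sup>2) - integral {x..y} (\<lambda>r. (u r)\<^sup>2) / a \<le> y * (G y)\<^sup>2 - x * (G x)\<^sup>2"
    proof (rule has_integral_le[OF l w])
      fix r
      \<comment> \<open>Completing the square with weight \<open>a\<close> is what produces the
        sharp constant; equality would require \<open>u = - a G\<close>.\<close>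
      have "2 * a * (G r)\<^sup>2 + 2 * G r * u r - (a * (G r)\<^sup>2 - (u r)\<^sup>2 / a) = (a * G r + u r)\<^sup>2 / a"
        using a(1) by (simp add: field_simps power2_eq_square)
      then show "a * (G r)\<^sup>2 - (u r)\<^sup>2 / a \<le> 2 * a * (G r)\<^sup>2 + 2 * G r * u r"
        using a(1) by (smt (verit) divide_nonneg_pos zero_le_power2)
    qed
    \<comment> \<open>The boundary term at the left end has a favourable sign and is dropped, so no
      information about \<open>G\<close> near 0 enters.\<close>
    also have "\<dots> \<le> y * (G y)\<^sup>2"
      using xy by simp
    finally have "a * integral {x..y} (\<lambda>r. (G r)\<^sup>2) \<le> y * (G y)\<^sup>2 + integral {x..y} (\<lambda>r. (u r)\<^sup>2) / a"
      by simp
    also have "\<dots> \<le> y * (G y)\<^sup>2 + (L2norm u)\<^sup>2 / a"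
      using a square_integrable_on_Icc(2)[OF sq xy(1)] by (intro add_left_mono divide_right_mono) auto
    finally show ?thesis
      using a by (simp add: B_def field_simps power2_eq_square)
  qed
  \<comment> \<open>The boundary term at the right end is removed by enlarging the interval to
    \<open>{x..z}\<close> and letting \<open>z\<close> tend to infinity.\<close>
  have bd2: "integral {x..y} (\<lambda>r. (G r)\<^sup>2) \<le> B" if xy: "0 < x" "x < y" for x y
  proof (rule tendsto_lowerbound[OF _ _ trivial_limit_at_top_linorder])
    have "((\<lambda>z. z * (G z)\<^sup>2 / a + B) \<longlongrightarrow> 0 / a + B) at_top"
      using a by (intro tendsto_intros euler_ode_decay[OF ode sq c lim]) auto
    then show "((\<lambda>z. z * (G z)\<^sup>2 / a + B) \<longlongrightarrow> B) at_top"
      by simp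
    show "\<forall>\<^sub>F z in at_top. integral {x..y} (\<lambda>r. (G r)\<^sup>2) \<le> z * (G z)\<^sup>2 / a + B"
      using eventually_ge_at_top[of y]
    proof eventually_elim
      case (elim z)
      have "integral {x..y} (\<lambda>r. (G r)\<^sup>2) \<le> integral {x..z} (\<lambda>r. (G r)\<^sup>2)"
        using elim xy int_G2[OF xy(1)] by (intro integral_subset_le) auto
      also have "\<dots> \<le> z * (G z)\<^sup>2 / a + B"
        using elim xy by (intro bd) auto
      finally show ?case .
    qed
  qed
  note * = square_integrable_continuous_bounded[OF cont bd2]
  show "square_integrable G"
    by (rule *(1))
  have "(a * L2norm G)\<^sup>2 \<le> (L2norm u)\<^sup>2"
    using *(2) a by (simp add: B_def power_mult_distrib field_simps)
  then show "(c + 1 / 2) * L2norm G \<le> L2norm u"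
    unfolding a_def[symmetric] by (rule power2_le_imp_le) simp
qed

text \<open>Subtracting the homogeneous solution with the limiting coefficient restores the decay
  hypothesis of Hardy's inequality and leaves the source \<open>u\<close> unchanged.\<close>

lemma euler_ode_hardy_decomposition:
  assumes ode: "euler_ode c G u" and sq: "square_integrable u" and c: "- 1 / 2 < c"
  obtains \<gamma> where
    "euler_ode c (\<lambda>r. G r - \<gamma> * r powr c) u"
    "square_integrable (\<lambda>r. G r - \<gamma> * r powr c)"
    "(c + 1 / 2) * L2norm (\<lambda>r. G r - \<gamma> * r powr c) \<le> L2norm u"
proof -
  obtain \<gamma> where g: "((\<lambda>r. G r * r powr (- c)) \<longlongrightarrow> \<gamma>) at_top"
    using euler_ode_scaled_limit[OF assms] .
  have ode': "euler_ode c (\<lambda>r. G r - \<gamma> * r powr c) u"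
    by (rule euler_ode_diff_powr[OF ode])
  have "((\<lambda>r. G r * r powr (- c) - \<gamma>) \<longlongrightarrow> \<gamma> - \<gamma>) at_top"
    by (intro tendsto_intros g)
  then have "((\<lambda>r. G r * r powr (- c) - \<gamma>) \<longlongrightarrow> 0) at_top"
    by simp
  then have "((\<lambda>r. (G r - \<gamma> * r powr c) * r powr (- c)) \<longlongrightarrow> 0) at_top"
    by (rule Lim_transform_eventually)
       (intro eventually_mono[OF eventually_gt_at_top[of 0]],
         simp add: left_diff_distrib mult.assoc powr_add[symmetric])
  from hardy_inequality[OF ode' sq c this] ode' that show thesis
    by blast
qed

section \<open>The lower bound\<close>

text \<open>With a nonzero limit, \<open>q\<close> would stay away from 0 on a half-line, because
  \<open>p\<close> is nonnegative, and its square would have arbitrarily large integrals.\<close>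

lemma square_integrable_growth_eq_0:
  assumes sq: "square_integrable q" and p: "0 \<le> p"
    and lim: "((\<lambda>r. q r * r powr (- p)) \<longlongrightarrow> \<gamma>) at_top"
  shows "\<gamma> = 0"
proof (rule ccontr)
  assume g: "\<gamma> \<noteq> 0"
  define m where "m = \<bar>\<gamma>\<bar> / 2"
  have m: "0 < m" using g by (simp add: m_def)
  have "((\<lambda>r. \<bar>q r * r powr (- p)\<bar>) \<longlongrightarrow> \<bar>\<gamma>\<bar>) at_top"
    by (intro tendsto_intros lim)
  then have "eventually (\<lambda>r. m < \<bar>q r * r powr (- p)\<bar>) at_top"
    using g by (intro order_tendstoD) (auto simp: m_def)
  then obtain x0 where x0: "\<And>r. x0 \<le> r \<Longrightarrow> m < \<bar>q r * r powr (- p)\<bar>"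
    by (auto simp: eventually_at_top_linorder)
  define x where "x = max x0 1"
  have x: "0 < x" by (simp add: x_def)
  have q: "m\<^sup>2 \<le> (q r)\<^sup>2" if "x \<le> r" for r
  proof -
    have r: "1 \<le> r" "x0 \<le> r" using that by (auto simp: x_def)
    have "m < \<bar>q r\<bar> * r powr (- p)"
      using x0[OF r(2)] by (simp add: abs_mult)
    also have "\<dots> \<le> \<bar>q r\<bar> * 1"
      using r p by (intro mult_left_mono) (auto simp: powr_le_one_le powr_minus inverse_le_1_iff ge_one_powr_ge_zero)
    finally have "m \<le> \<bar>q r\<bar>" by simp
    then have "m\<^sup>2 \<le> \<bar>q r\<bar>\<^sup>2"
      using m by (intro power_mono) auto
    then show ?thesis by simp
  qed
  have bd: "n * m\<^sup>2 \<le> (L2norm q)\<^sup>2" if "0 < n" for n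
  proof -
    have "n * m\<^sup>2 = integral {x..x + n} (\<lambda>r. m\<^sup>2)"
      using that by simp
    also have "\<dots> \<le> integral {x..x + n} (\<lambda>r. (q r)\<^sup>2)"
      using q square_integrable_on_Icc(1)[OF sq x] by (intro integral_le) auto
    also have "\<dots> \<le> (L2norm q)\<^sup>2"
      by (rule square_integrable_on_Icc(2)[OF sq x])
    finally show ?thesis .
  qed
  \<comment> \<open>This length makes \<open>n * m\<^sup>2\<close> equal to the squared norm plus
    1.\<close>
  define n where "n = ((L2norm q)\<^sup>2 + 1) / m\<^sup>2"
  have "0 < n" using m by (simp add: n_def add_nonneg_pos)
  from bd[OF this] show False
    using m by (simp add: n_def)
qed

text \<open>A derivative is the pointwise limit of continuous difference quotients. This covers the
  third derivative of a normalized function, which exists everywhere but may be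
  discontinuous.\<close>

lemma set_borel_measurable_deriv:
  assumes d: "\<And>r. 0 < r \<Longrightarrow> (f has_real_derivative f' r) (at r)"
  shows "set_borel_measurable lborel {0<..} f'"
  unfolding set_borel_measurable_def
proof (rule borel_measurable_LIMSEQ_real)
  define h where "h n = 1 / real (n + 1)" for n
  have h: "0 < h n" for n by (simp add: h_def)
  have h0: "h \<longlonglongrightarrow> 0" unfolding h_def by real_asymp
  have cont: "continuous_on {0<..} f"
    by (intro continuous_at_imp_continuous_on ballI DERIV_isCont) (auto intro: d)
  have hl: "filterlim h (at 0) sequentially"
    using h0 h by (auto simp: filterlim_at intro!: always_eventually) (metis less_irrefl)
  show "(\<lambda>n. indicator {0<..} r *\<^sub>R ((f (r + h n) - f r) / h n)) \<longlonglongrightarrow> indicator {0<..} r *\<^sub>R f' r"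
    for r
  proof (cases "0 < r")
    case True
    then have "((\<lambda>h. (f (r + h) - f r) / h) \<longlongrightarrow> f' r) (at 0)"
      using d[OF True] by (simp add: DERIV_def)
    from filterlim_compose[OF this hl] show ?thesis
      using True by simp
  qed simp
  show "(\<lambda>r. indicator {0<..} r *\<^sub>R ((f (r + h n) - f r) / h n)) \<in> borel_measurable lborel" for n
  proof -
    have "continuous_on {0<..} (\<lambda>r. (f (r + h n) - f r) / h n)"
      using h[of n] by (intro continuous_intros cont continuous_on_compose2[OF cont])
        (auto intro: add_pos_pos)
    from borel_measurable_continuous_on_indicator[OF _ this] show ?thesis
      by (simp del: real_scaleR_def)
  qed
qed

lemma euler_ode_measurable:
  assumes ode: "euler_ode c G u"
  shows "set_borel_measurable lborel {0<..} u"
proof -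
  have "set_borel_measurable lborel {0<..} (\<lambda>r. (c * G r + u r) / r)"
    by (rule set_borel_measurable_deriv[of G]) (rule euler_odeD[OF ode])
  \<comment> \<open>The source is recovered from the solution as
    \<open>u = r G' - c G\<close>.\<close>
  then have "(\<lambda>r. r * (indicator {0<..} r *\<^sub>R ((c * G r + u r) / r))
      - c * (indicator {0<..} r *\<^sub>R G r)) \<in> borel_measurable lborel"
    using set_measurable_continuous_on[OF _ euler_ode_continuous_on[OF ode]]
    unfolding set_borel_measurable_def by measurable
  also have "(\<lambda>r. r * (indicator {0<..} r *\<^sub>R ((c * G r + u r) / r))
      - c * (indicator {0<..} r *\<^sub>R G r)) = (\<lambda>r. indicator {0<..} r *\<^sub>R u r)"
    by (auto simp: indicator_def field_simps)
  finally show ?thesis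
    by (simp add: set_borel_measurable_def)
qed

section \<open>Normalized functions, and the functional as a squared norm\<close>

lemma normalizedD:
  assumes "normalized f"
  shows "0 < r \<Longrightarrow> (f has_real_derivative deriv f r) (at r)"
    and "0 < r \<Longrightarrow> (deriv f has_real_derivative (deriv ^^ 2) f r) (at r)"
    and "0 < r \<Longrightarrow> ((deriv ^^ 2) f has_real_derivative (deriv ^^ 3) f r) (at r)"
    and "L2norm f = 1"
proof -
  have d: "((deriv ^^ k) f has_real_derivative (deriv ^^ Suc k) f r) (at r)" if "0 < r" "k < 3" for k r
    using assms that by (auto simp: normalized_def DERIV_deriv_iff_real_differentiable)
  show "0 < r \<Longrightarrow> (f has_real_derivative deriv f r) (at r)"
    "0 < r \<Longrightarrow> (deriv f has_real_derivative (deriv ^^ 2) f r) (at r)"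
    "0 < r \<Longrightarrow> ((deriv ^^ 2) f has_real_derivative (deriv ^^ 3) f r) (at r)"
    using d[of r 0] d[of r 1] d[of r 2] by (simp_all add: numeral_2_eq_2 numeral_3_eq_3)
  show "L2norm f = 1"
    using assms by (simp add: normalized_def)
qed

lemma normalized_square_integrable:
  assumes "normalized f"
  shows "square_integrable f"
proof -
  have "continuous_on {0<..} f"
    by (intro continuous_at_imp_continuous_on ballI DERIV_isCont[OF normalizedD(1)[OF assms]]) auto
  then have "set_borel_measurable lborel {0<..} f"
    using set_measurable_continuous_on[of "{0<..}" f] by (simp add: set_borel_measurable_def)
  moreover have "set_integrable lborel {0<..} (\<lambda>r. (f r)\<^sup>2)"
  proof (rule ccontr)
    assume "\<not> ?thesis"
    then have "L2norm f = 0"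
      by (simp add: L2norm_def set_integrable_def set_lebesgue_integral_def not_integrable_integral_eq)
    then show False
      using normalizedD(4)[OF assms] by simp
  qed
  ultimately show ?thesis
    by (simp add: square_integrable_def)
qed

lemma nn_integral_square_integrable:
  assumes "square_integrable u"
  shows "(\<integral>\<^sup>+ r\<in>{0<..}. ennreal ((u r)\<^sup>2) \<partial>lborel) = ennreal ((L2norm u)\<^sup>2)"
proof -
  have i: "integrable lborel (\<lambda>r. indicator {0<..} r * (u r)\<^sup>2)"
    using assms by (simp add: square_integrable_def set_integrable_def)
  have "(\<integral>\<^sup>+ r\<in>{0<..}. ennreal ((u r)\<^sup>2) \<partial>lborel) =
      (\<integral>\<^sup>+ r. ennreal (indicator {0<..} r * (u r)\<^sup>2) \<partial>lborel)"
    by (intro nn_integral_cong) (auto simp: indicator_def)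
  also have "\<dots> = ennreal (\<integral>r. indicator {0<..} r * (u r)\<^sup>2 \<partial>lborel)"
    by (rule nn_integral_eq_integral[OF i]) auto
  finally show ?thesis
    by (simp add: L2norm_power2 set_lebesgue_integral_def)
qed

lemma square_integrable_nn_integral:
  assumes m: "set_borel_measurable lborel {0<..} u"
    and fin: "(\<integral>\<^sup>+ r\<in>{0<..}. ennreal ((u r)\<^sup>2) \<partial>lborel) < \<infinity>"
  shows "square_integrable u"
proof -
  have "(\<lambda>r. (indicator {0<..} r *\<^sub>R u r)\<^sup>2) \<in> borel_measurable lborel"
    using m unfolding set_borel_measurable_def by measurable
  also have "(\<lambda>r. (indicator {0<..} r *\<^sub>R u r)\<^sup>2) = (\<lambda>r. indicator {0<..} r * (u r)\<^sup>2)"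
    by (auto simp: indicator_def)
  finally have m2: "(\<lambda>r. indicator {0<..} r * (u r)\<^sup>2) \<in> borel_measurable lborel" .
  have "(\<integral>\<^sup>+ r. ennreal (norm (indicator {0<..} r * (u r)\<^sup>2)) \<partial>lborel) =
      (\<integral>\<^sup>+ r\<in>{0<..}. ennreal ((u r)\<^sup>2) \<partial>lborel)"
    by (intro nn_integral_cong) (auto simp: indicator_def)
  then have "integrable lborel (\<lambda>r. indicator {0<..} r * (u r)\<^sup>2)"
    using fin by (intro integrableI_bounded m2) simp
  then show ?thesis
    using m by (simp add: square_integrable_def set_integrable_def)
qed

text \<open>The chain is \<open>f1 = D f\<close>, \<open>f2 = (D - 1/3) f1\<close>,
  \<open>2/9 P = (D - 2/3) f2\<close>. A finite functional makes \<open>P\<close> square integrable,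
  and the factors are inverted one after another from there, each with its own homogeneous
  remainder.\<close>

lemma Z6_lower_bound:
  assumes n: "normalized f"
  shows "ennreal (35 / 4096) \<le> Z6 f"
proof (cases "Z6 f = \<infinity>")
  case False
  note d = normalizedD[OF n]
  note sf = normalized_square_integrable[OF n]
  define P where "P r = r * deriv f r + 9 * r ^ 2 * (deriv ^^ 2) f r + 9 / 2 * r ^ 3 * (deriv ^^ 3) f r" for r
  have Z: "Z6 f = ennreal (1 / 560) * (\<integral>\<^sup>+ r\<in>{0<..}. ennreal ((P r)\<^sup>2) \<partial>lborel)"
    by (simp add: Z6_def P_def)
  define f1 where "f1 r = r * deriv f r" for r
  define f2 where "f2 r = 2 / 3 * r * deriv f r + r\<^sup>2 * (deriv ^^ 2) f r" for r
  have o0: "euler_ode 0 f f1"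
    using d(1) by (auto simp: euler_ode_def f1_def)
  have o1: "euler_ode (1 / 3) f1 f2"
    unfolding euler_ode_def
  proof (intro allI impI)
    fix r :: real assume r: "0 < r"
    have "(f1 has_real_derivative (deriv f r + r * (deriv ^^ 2) f r)) (at r)"
      unfolding f1_def[abs_def] using r by (auto intro!: derivative_eq_intros d)
    also have "deriv f r + r * (deriv ^^ 2) f r = (1 / 3 * f1 r + f2 r) / r"
      using r by (simp add: f1_def f2_def field_simps power2_eq_square)
    finally show "(f1 has_real_derivative (1 / 3 * f1 r + f2 r) / r) (at r)" .
  qed
  have d2: "(f2 has_real_derivative (2 / 3 * deriv f r + 8 / 3 * r * (deriv ^^ 2) f r + r\<^sup>2 * (deriv ^^ 3) f r)) (at r)"
    if r: "0 < r" for r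
    unfolding f2_def[abs_def] using r
    by (auto intro!: derivative_eq_intros d simp: field_simps)
  have o2: "euler_ode (2 / 3) f2 (\<lambda>r. 2 / 9 * P r)"
    unfolding euler_ode_def
  proof (intro allI impI)
    fix r :: real assume r: "0 < r"
    note d2[OF r]
    also have "2 / 3 * deriv f r + 8 / 3 * r * (deriv ^^ 2) f r + r\<^sup>2 * (deriv ^^ 3) f r
       = (2 / 3 * f2 r + 2 / 9 * P r) / r"
      using r by (simp add: P_def f2_def field_simps power2_eq_square power3_eq_cube)
    finally show "(f2 has_real_derivative (2 / 3 * f2 r + 2 / 9 * P r) / r) (at r)" .
  qed
  have "(\<lambda>r. 9 / 2 * (indicator {0<..} r *\<^sub>R (2 / 9 * P r))) \<in> borel_measurable lborel"
    using euler_ode_measurable[OF o2] unfolding set_borel_measurable_def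
    by (rule borel_measurable_times[OF borel_measurable_const])
  then have mP: "set_borel_measurable lborel {0<..} P"
    by (simp add: set_borel_measurable_def mult.commute)
  have sP: "square_integrable P"
    using False by (intro square_integrable_nn_integral mP)
      (auto simp: Z ennreal_mult_eq_top_iff top.not_eq_extremum)
  obtain \<gamma> where g: "euler_ode (2 / 3) (\<lambda>r. f2 r - \<gamma> * r powr (2 / 3)) (\<lambda>r. 2 / 9 * P r)"
    "square_integrable (\<lambda>r. f2 r - \<gamma> * r powr (2 / 3))"
    "(2 / 3 + 1 / 2) * L2norm (\<lambda>r. f2 r - \<gamma> * r powr (2 / 3)) \<le> L2norm (\<lambda>r. 2 / 9 * P r)"
    by (rule euler_ode_hardy_decomposition[OF o2 square_integrable_cmult[OF sP]]) auto
  define H2 where "H2 r = f2 r - \<gamma> * r powr (2 / 3)" for r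
  \<comment> \<open>The factor 3 comes from \<open>(D - 1/3) r^(2/3) = 1/3 r^(2/3)\<close>:
    subtracting \<open>3 \<gamma> r^(2/3)\<close> from \<open>f1\<close> subtracts
    \<open>\<gamma> r^(2/3)\<close> from its source.\<close>
  have "euler_ode (1 / 3) (\<lambda>r. f1 r - 3 * \<gamma> * r powr (2 / 3)) H2"
    unfolding euler_ode_def
  proof (intro allI impI)
    fix r :: real assume r: "0 < r"
    have "((\<lambda>r. f1 r - 3 * \<gamma> * r powr (2 / 3)) has_real_derivative
        (1 / 3 * f1 r + f2 r) / r - 3 * \<gamma> * (2 / 3 * r powr (2 / 3 - 1))) (at r)"
      using r by (auto intro!: derivative_eq_intros euler_odeD[OF o1])
    also have "(1 / 3 * f1 r + f2 r) / r - 3 * \<gamma> * (2 / 3 * r powr (2 / 3 - 1))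
       = (1 / 3 * (f1 r - 3 * \<gamma> * r powr (2 / 3)) + H2 r) / r"
      unfolding powr_diff using r by (simp add: H2_def field_simps)
    finally show "((\<lambda>r. f1 r - 3 * \<gamma> * r powr (2 / 3)) has_real_derivative
        (1 / 3 * (f1 r - 3 * \<gamma> * r powr (2 / 3)) + H2 r) / r) (at r)" .
  qed
  then obtain \<beta> where b: "euler_ode (1 / 3) (\<lambda>r. f1 r - 3 * \<gamma> * r powr (2 / 3) - \<beta> * r powr (1 / 3)) H2"
    "square_integrable (\<lambda>r. f1 r - 3 * \<gamma> * r powr (2 / 3) - \<beta> * r powr (1 / 3))"
    "(1 / 3 + 1 / 2) * L2norm (\<lambda>r. f1 r - 3 * \<gamma> * r powr (2 / 3) - \<beta> * r powr (1 / 3)) \<le> L2norm H2"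
    by (rule euler_ode_hardy_decomposition[OF _ g(2)[folded H2_def]]) auto
  define H1 where "H1 r = f1 r - 3 * \<gamma> * r powr (2 / 3) - \<beta> * r powr (1 / 3)" for r
  \<comment> \<open>In the same way \<open>D\<close> multiplies \<open>r^(2/3)\<close> by 2/3 and
    \<open>r^(1/3)\<close> by 1/3, which gives the coefficients \<open>9/2 \<gamma>\<close> and
    \<open>3 \<beta>\<close>.\<close>
  have "euler_ode 0 (\<lambda>r. f r - 9 / 2 * \<gamma> * r powr (2 / 3) - 3 * \<beta> * r powr (1 / 3)) H1"
    unfolding euler_ode_def
  proof (intro allI impI)
    fix r :: real assume r: "0 < r"
    have "((\<lambda>r. f r - 9 / 2 * \<gamma> * r powr (2 / 3) - 3 * \<beta> * r powr (1 / 3)) has_real_derivative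
        (0 * f r + f1 r) / r - 9 / 2 * \<gamma> * (2 / 3 * r powr (2 / 3 - 1)) - 3 * \<beta> * (1 / 3 * r powr (1 / 3 - 1))) (at r)"
      using r by (auto intro!: derivative_eq_intros euler_odeD[OF o0])
    also have "(0 * f r + f1 r) / r - 9 / 2 * \<gamma> * (2 / 3 * r powr (2 / 3 - 1)) - 3 * \<beta> * (1 / 3 * r powr (1 / 3 - 1))
       = (0 * (f r - 9 / 2 * \<gamma> * r powr (2 / 3) - 3 * \<beta> * r powr (1 / 3)) + H1 r) / r"
      unfolding powr_diff using r by (simp add: H1_def field_simps)
    finally show "((\<lambda>r. f r - 9 / 2 * \<gamma> * r powr (2 / 3) - 3 * \<beta> * r powr (1 / 3)) has_real_derivative
      (0 * (f r - 9 / 2 * \<gamma> * r powr (2 / 3) - 3 * \<beta> * r powr (1 / 3)) + H1 r) / r) (at r)" .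
  qed
  then obtain \<alpha> where a:
    "square_integrable (\<lambda>r. f r - 9 / 2 * \<gamma> * r powr (2 / 3) - 3 * \<beta> * r powr (1 / 3) - \<alpha> * r powr 0)"
    "(0 + 1 / 2) * L2norm (\<lambda>r. f r - 9 / 2 * \<gamma> * r powr (2 / 3) - 3 * \<beta> * r powr (1 / 3) - \<alpha> * r powr 0) \<le> L2norm H1"
    by (rule euler_ode_hardy_decomposition[OF _ b(2)[folded H1_def]]) auto
  \<comment> \<open>As the difference of two square integrable functions, the total homogeneous part
    is square integrable. Its coefficients are eliminated in the order of decreasing exponents, the
    leading power being detected by its growth.\<close>
  define q where "q r = 9 / 2 * \<gamma> * r powr (2 / 3) + 3 * \<beta> * r powr (1 / 3) + \<alpha> * r powr 0" for r
  have sq: "square_integrable q"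
    using square_integrable_diff[OF sf a(1)] by (simp add: q_def[abs_def] add.assoc)
  have "\<gamma> = 0"
  proof -
    have "((\<lambda>r. q r * r powr (- (2 / 3))) \<longlongrightarrow> 9 / 2 * \<gamma>) at_top"
      unfolding q_def by real_asymp
    then show ?thesis
      using square_integrable_growth_eq_0[OF sq, of "2 / 3" "9 / 2 * \<gamma>"] by simp
  qed
  moreover from this have "\<beta> = 0"
  proof -
    have "((\<lambda>r. (3 * \<beta> * r powr (1 / 3) + \<alpha> * r powr 0) * r powr (- (1 / 3))) \<longlongrightarrow> 3 * \<beta>) at_top"
      by real_asymp
    then show ?thesis
      using square_integrable_growth_eq_0[OF sq, of "1 / 3" "3 * \<beta>"] \<open>\<gamma> = 0\<close> by (simp add: q_def)
  qed
  moreover from calculation have "\<alpha> = 0"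
  proof -
    have "((\<lambda>r. (\<alpha> * r powr 0) * r powr (- 0)) \<longlongrightarrow> \<alpha>) at_top"
      by real_asymp
    then show ?thesis
      using square_integrable_growth_eq_0[OF sq, of 0 "\<alpha>"] \<open>\<gamma> = 0\<close> \<open>\<beta> = 0\<close> by (simp add: q_def)
  qed
  ultimately have z: "\<gamma> = 0" "\<beta> = 0" "\<alpha> = 0"
    by auto
  \<comment> \<open>The constant is \<open>9/2 * 7/6 * 5/6 * 1/2\<close>, one Hardy constant per
    factor.\<close>
  have "35 / 16 \<le> L2norm P"
    using g(3) b(3) a(2) d(4) unfolding z H1_def[abs_def] H2_def[abs_def] L2norm_cmult by simp
  then have "(35 / 16)\<^sup>2 \<le> (L2norm P)\<^sup>2"
    by (rule power_mono) simp
  then have "35 / 4096 \<le> 1 / 560 * (L2norm P)\<^sup>2"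
    by (simp add: power2_eq_square)
  then have "ennreal (35 / 4096) \<le> ennreal (1 / 560 * (L2norm P)\<^sup>2)"
    by (rule ennreal_leI)
  also have "\<dots> = ennreal (1 / 560) * ennreal ((L2norm P)\<^sup>2)"
    by (rule ennreal_mult) auto
  also have "\<dots> = Z6 f"
    unfolding Z nn_integral_square_integrable[OF sP] ..
  finally show ?thesis .
qed simp

section \<open>Near-equality in Hardy's inequality\<close>

text \<open>By continuity a solution of norm zero vanishes identically, hence so does its source.
  This is how norms appearing as divisors are shown to be nonzero.\<close>

lemma euler_ode_eq_0:
  assumes ode: "euler_ode c G u" and sq: "square_integrable G" and z: "L2norm G = 0" and r: "0 < r"
  shows "G r = 0" "u r = 0"
proof -
  note cont = euler_ode_continuous_on[OF ode]
  have G0: "G x = 0" if x: "0 < x" for x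
  proof -
    have cont2: "continuous_on {x..x + 1} (\<lambda>r. (G r)\<^sup>2)"
      using x by (intro continuous_intros continuous_on_subset[OF cont]) auto
    have "integral {x..x + 1} (\<lambda>r. (G r)\<^sup>2) \<le> 0"
      using square_integrable_on_Icc(2)[OF sq x, of "x + 1"] z by simp
    moreover have "0 \<le> integral {x..x + 1} (\<lambda>r. (G r)\<^sup>2)"
      using cont2 by (intro integral_nonneg integrable_continuous_real) auto
    ultimately have "\<forall>r\<in>{x..x + 1}. (G r)\<^sup>2 = 0"
      using integral_eq_0_iff[OF cont2] by simp
    then show ?thesis by simp
  qed
  then show "G r = 0"
    using r by blast
  have "((\<lambda>x. 0) has_real_derivative (c * G r + u r) / r) (at r)"
    by (rule has_field_derivative_transform_within_open[OF euler_odeD[OF ode r], of "{0<..}"])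
      (use r G0 in auto)
  then have "(c * G r + u r) / r = 0"
    using DERIV_unique[OF _ DERIV_const] by blast
  then show "u r = 0"
    using r G0 by simp
qed

text \<open>
  \<open>euler_ode (- 1 / 2) u e\<close> says \<open>e = E u\<close> for the antisymmetric dilation generator
  \<open>E = r d/dr + 1/2\<close>. It commutes with \<open>r d/dr - c\<close>, so a small \<open>E u\<close> forces a small \<open>E G\<close>, and
  \<open>u = E G - (c + 1/2) G\<close> nearly attains equality in Hardy's inequality.
\<close>

lemma hardy_near_equality:
  assumes G: "euler_ode c G u" and u: "euler_ode (- 1 / 2) u e"
    and squ: "square_integrable u" and sqe: "square_integrable e" and c: "- 1 / 2 < c"
    and limG: "((\<lambda>r. G r * r powr (- c)) \<longlongrightarrow> 0) at_top"
    and limu: "((\<lambda>r. u r * r powr (- c)) \<longlongrightarrow> 0) at_top"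
  defines "e' \<equiv> \<lambda>r. (c + 1 / 2) * G r + u r"
  shows "euler_ode (- 1 / 2) G e'" "square_integrable G" "square_integrable e'"
    "(c + 1 / 2) * L2norm e' \<le> L2norm e" "L2norm u \<le> (c + 1 / 2) * L2norm G + L2norm e'"
proof -
  show "euler_ode (- 1 / 2) G e'"
    using G unfolding euler_ode_def e'_def by (simp add: algebra_simps)
  \<comment> \<open>Here \<open>e' = E G\<close>, and commuting \<open>E\<close> past
    \<open>D - c\<close> gives \<open>(D - c) e' = E u = e\<close>. Hardy's inequality thus bounds
    \<open>e'\<close> by \<open>e\<close> exactly as it bounds \<open>G\<close> by
    \<open>u\<close>.\<close>
  have ode: "euler_ode c e' e"
    unfolding euler_ode_def
  proof (intro allI impI)
    fix r :: real assume r: "0 < r"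
    have "(e' has_real_derivative (c + 1 / 2) * ((c * G r + u r) / r) + (- 1 / 2 * u r + e r) / r) (at r)"
      unfolding e'_def using euler_odeD[OF G r] euler_odeD[OF u r]
      by (intro DERIV_add DERIV_cmult)
    also have "(c + 1 / 2) * ((c * G r + u r) / r) + (- 1 / 2 * u r + e r) / r = (c * e' r + e r) / r"
      using r by (simp add: e'_def field_simps)
    finally show "(e' has_real_derivative (c * e' r + e r) / r) (at r)" .
  qed
  have "((\<lambda>r. (c + 1 / 2) * (G r * r powr (- c)) + u r * r powr (- c)) \<longlongrightarrow> (c + 1 / 2) * 0 + 0) at_top"
    by (intro tendsto_intros limG limu)
  then have lim: "((\<lambda>r. e' r * r powr (- c)) \<longlongrightarrow> 0) at_top"
    by (simp add: e'_def algebra_simps)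
  show sqG: "square_integrable G"
    by (rule hardy_inequality(1)[OF G squ c limG])
  show sqe': "square_integrable e'"
    by (rule hardy_inequality(1)[OF ode sqe c lim])
  show "(c + 1 / 2) * L2norm e' \<le> L2norm e"
    by (rule hardy_inequality(2)[OF ode sqe c lim])
  have "u = (\<lambda>r. - (c + 1 / 2) * G r + e' r)"
    by (simp add: e'_def algebra_simps)
  then have "L2norm u = L2norm (\<lambda>r. - (c + 1 / 2) * G r + e' r)"
    by simp
  also have "\<dots> \<le> L2norm (\<lambda>r. - (c + 1 / 2) * G r) + L2norm e'"
    by (intro L2norm_triangle square_integrable_cmult sqG sqe')
  also have "L2norm (\<lambda>r. - (c + 1 / 2) * G r) = (c + 1 / 2) * L2norm G"
    using c by (subst L2norm_cmult) simp
  finally show "L2norm u \<le> (c + 1 / 2) * L2norm G + L2norm e'" .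
qed

text \<open>The integral of \<open>(b - l m)^2 / m\<close> is nonnegative, and \<open>l\<close> is
  taken at the minimum, the quotient of the integrals of \<open>b\<close> and
  \<open>m\<close>.\<close>

lemma integral_weighted_Cauchy_Schwarz:
  fixes b m :: "real \<Rightarrow> real"
  assumes b: "continuous_on {x..y} b" and m: "continuous_on {x..y} m"
    and pos: "\<And>t. t \<in> {x..y} \<Longrightarrow> 0 < m t" and xy: "x < y"
  shows "(integral {x..y} b)\<^sup>2 \<le> integral {x..y} m * integral {x..y} (\<lambda>t. (b t)\<^sup>2 / m t)"
proof -
  define M where "M = integral {x..y} m"
  define l where "l = integral {x..y} b / M"
  have ne: "m t \<noteq> 0" if "t \<in> {x..y}" for t
    using pos[OF that] by simp
  have cB: "continuous_on {x..y} (\<lambda>t. (b t)\<^sup>2 / m t)"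
    using ne by (intro continuous_intros b m) auto
  have "0 \<le> M"
    unfolding M_def by (intro integral_nonneg integrable_continuous_real m less_imp_le pos)
  moreover have "M \<noteq> 0"
    using integral_eq_0_iff[OF m xy] pos ne[of x] xy by (force simp: M_def less_imp_le)
  ultimately have M: "0 < M" by simp
  have "((\<lambda>t. (b t)\<^sup>2 / m t - 2 * l * b t + l\<^sup>2 * m t) has_integral
      (integral {x..y} (\<lambda>t. (b t)\<^sup>2 / m t) - 2 * l * integral {x..y} b + l\<^sup>2 * M)) {x..y}"
    unfolding M_def
    by (intro has_integral_add has_integral_diff has_integral_mult_right integrable_integral
          integrable_continuous_real cB b m)
  then have "0 \<le> integral {x..y} (\<lambda>t. (b t)\<^sup>2 / m t) - 2 * l * integral {x..y} b + l\<^sup>2 * M"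
  proof (rule has_integral_nonneg)
    fix t assume t: "t \<in> {x..y}"
    have "(b t)\<^sup>2 / m t - 2 * l * b t + l\<^sup>2 * m t = (b t - l * m t)\<^sup>2 / m t"
      using ne[OF t] by (simp add: field_simps power2_eq_square)
    then show "0 \<le> (b t)\<^sup>2 / m t - 2 * l * b t + l\<^sup>2 * m t"
      using pos[OF t] by simp
  qed
  then have "0 \<le> M * (integral {x..y} (\<lambda>t. (b t)\<^sup>2 / m t) - 2 * l * integral {x..y} b + l\<^sup>2 * M)"
    using M by simp
  also have "\<dots> = M * integral {x..y} (\<lambda>t. (b t)\<^sup>2 / m t) - (integral {x..y} b)\<^sup>2"
    using M by (simp add: l_def field_simps power2_eq_square)
  finally show ?thesis
    by (simp add: M_def)
qed

text \<open>Iterating \<open>deriv\<close> needs each formula on a whole neighbourhood, not only at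
  \<open>r\<close>; openness of the half-line provides it.\<close>

lemma higher_derivs_eq:
  assumes f: "\<And>r. 0 < r \<Longrightarrow> (f has_real_derivative f1 r) (at r)"
    "\<And>r. 0 < r \<Longrightarrow> (f1 has_real_derivative f2 r) (at r)"
    "\<And>r. 0 < r \<Longrightarrow> (f2 has_real_derivative f3 r) (at r)"
    and r: "0 < r"
  shows "deriv f r = f1 r" "(deriv ^^ 2) f r = f2 r" "(deriv ^^ 3) f r = f3 r"
    and "\<And>k. k < 3 \<Longrightarrow> ((deriv ^^ k) f) differentiable (at r)"
proof -
  have step: "(deriv g has_real_derivative g2 r) (at r)"
    if "\<And>r. 0 < r \<Longrightarrow> (g has_real_derivative g1 r) (at r)" "\<And>r. 0 < r \<Longrightarrow> (g1 has_real_derivative g2 r) (at r)"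
      "0 < r" for g g1 g2 :: "real \<Rightarrow> real" and r
    by (rule has_field_derivative_transform_within_open[OF that(2)[OF that(3)], of "{0<..}"])
      (use that(1,3) in \<open>auto intro!: DERIV_imp_deriv[symmetric]\<close>)
  have d2: "(deriv f has_real_derivative f2 r) (at r)" if "0 < r" for r
    using step[OF f(1,2) that] .
  have d3: "((deriv ^^ 2) f has_real_derivative f3 r) (at r)" if "0 < r" for r
    using step[OF d2 f(3) that] by (simp add: numeral_2_eq_2)
  show "deriv f r = f1 r" "(deriv ^^ 2) f r = f2 r" "(deriv ^^ 3) f r = f3 r"
    using DERIV_imp_deriv[OF f(1)[OF r]] DERIV_imp_deriv[OF d2[OF r]] DERIV_imp_deriv[OF d3[OF r]]
    by (simp_all add: numeral_2_eq_2 numeral_3_eq_3)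
  fix k :: nat assume "k < 3"
  then consider "k = 0" | "k = 1" | "k = 2" by linarith
  then show "((deriv ^^ k) f) differentiable (at r)"
    using f(1)[OF r] d2[OF r] d3[OF r] by cases (auto simp: real_differentiable_def)
qed

lemma nn_integral_continuous_Icc:
  fixes f :: "real \<Rightarrow> real"
  assumes f: "continuous_on {x..y} f" and nn: "\<And>t. t \<in> {x..y} \<Longrightarrow> 0 \<le> f t"
  shows "(\<integral>\<^sup>+ t\<in>{x..y}. ennreal (f t) \<partial>lborel) = ennreal (integral {x..y} f)"
proof -
  have i: "set_integrable lborel {x..y} f"
    by (rule borel_integrable_atLeastAtMost'[OF f])
  have "(\<integral>\<^sup>+ t\<in>{x..y}. ennreal (f t) \<partial>lborel) = (\<integral>\<^sup>+ t. ennreal (indicator {x..y} t * f t) \<partial>lborel)"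
    by (intro nn_integral_cong) (auto simp: indicator_def)
  also have "\<dots> = ennreal (\<integral>t. indicator {x..y} t * f t \<partial>lborel)"
    using i nn by (intro nn_integral_eq_integral) (auto simp: set_integrable_def indicator_def)
  also have "(\<integral>t. indicator {x..y} t * f t \<partial>lborel) = integral {x..y} f"
    using set_borel_integral_eq_integral(2)[OF i] by (simp add: set_lebesgue_integral_def)
  finally show ?thesis .
qed

lemma nn_integral_exp_quadratic:
  assumes l: "0 < l" and AB: "0 \<le> A" "0 \<le> B"
  shows "(\<integral>\<^sup>+ r\<in>{0<..}. ennreal ((A + B * r\<^sup>2) * exp (- (l * r))) \<partial>lborel) = ennreal (A / l + 2 * B / l ^ 3)"
proof -
  \<comment> \<open>The antiderivative obtained by integrating by parts twice; the value of the
    integral is \<open>- F 0\<close>.\<close>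
  define F where "F r = - ((A / l + B * (r\<^sup>2 / l + 2 * r / l\<^sup>2 + 2 / l ^ 3)) * exp (- (l * r)))" for r
  have "(\<integral>\<^sup>+ r\<in>{0<..}. ennreal ((A + B * r\<^sup>2) * exp (- (l * r))) \<partial>lborel)
      = (\<integral>\<^sup>+ r\<in>{0..}. ennreal ((A + B * r\<^sup>2) * exp (- (l * r))) \<partial>lborel)"
    by (intro nn_integral_cong_AE eventually_mono[OF AE_lborel_singleton[of 0]]) (auto simp: indicator_def)
  also have "\<dots> = ennreal (0 - F 0)"
  proof (rule nn_integral_FTC_atLeast)
    show "(\<lambda>r. (A + B * r\<^sup>2) * exp (- (l * r))) \<in> borel_measurable borel"
      by measurable
    show "(F has_real_derivative (A + B * r\<^sup>2) * exp (- (l * r))) (at r)" for r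
      unfolding F_def[abs_def] using l
      by (auto intro!: derivative_eq_intros simp: field_simps power2_eq_square power3_eq_cube)
    show "0 \<le> (A + B * r\<^sup>2) * exp (- (l * r))" for r
      using AB by simp
    show "(F \<longlongrightarrow> 0) at_top"
      unfolding F_def[abs_def] using l by real_asymp
  qed
  finally show ?thesis
    by (simp add: F_def add.commute mult.commute)
qed

lemma one_minus_cos_le: "1 - cos x \<le> x\<^sup>2 / 2" for x :: real
proof -
  have "1 - cos x = 2 * (sin (x / 2))\<^sup>2"
    using cos_double_sin[of "x / 2"] by simp
  also have "(sin (x / 2))\<^sup>2 \<le> (x / 2)\<^sup>2"
    using abs_sin_x_le_abs_x[of "x / 2"] by (simp only: abs_le_square_iff)
  finally show ?thesis
    by (simp add: power_divide)
qed

section \<open>The kernel of the four-partite family\<close>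

locale four_partite =
  fixes \<xi> :: real
  assumes xi: "0 < \<xi>" "\<xi> < 1"
begin

definition s where "s = sqrt \<xi>"

definition w where "w \<theta> = 1 + s * cos \<theta>" for \<theta>

lemma s: "0 < s" "s < 1" "s\<^sup>2 = \<xi>"
  using xi by (auto simp: s_def)

lemma s_cos_bounds: "- s \<le> s * cos \<theta>" "s * cos \<theta> \<le> s"
  using s mult_left_mono[of "-1" "cos \<theta>" s] mult_left_mono[of "cos \<theta>" 1 s] by auto

lemma w_bounds: "1 - s \<le> w \<theta>" "w \<theta> \<le> 2" "0 < w \<theta>"
  using s_cos_bounds[of \<theta>] s unfolding w_def by linarith+

lemma w_neq_0 [simp]: "w \<theta> \<noteq> 0"
  using w_bounds(3)[of \<theta>] by simp

lemma wbar_bounds: "1 - s \<le> 2 - w \<theta>" "2 - w \<theta> \<le> 2" "0 < 2 - w \<theta>"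
  using s_cos_bounds[of \<theta>] s unfolding w_def by linarith+

lemma gam_eq: "gam \<xi> \<theta> = 1 / 2 * ((2 - w \<theta>) / w \<theta>)"
  by (simp add: gam_def w_def s_def)

lemma gam_pos: "0 < gam \<xi> \<theta>"
  using w_bounds(3) wbar_bounds(3) by (simp add: gam_eq)

text \<open>Uniform in \<open>\<theta>\<close> for fixed \<open>\<xi>\<close>, this rate gives
  exponential decay in \<open>r\<close>. It tends to 0 as \<open>\<xi>\<close> tends to 1, so it
  serves integrability and limits at infinity, not the uniform bounds.\<close>

lemma gam_lower: "(1 - s) / 4 \<le> gam \<xi> \<theta>"
proof -
  have "(1 - s) / 2 \<le> (2 - w \<theta>) / w \<theta>"
    using w_bounds[of \<theta>] wbar_bounds[of \<theta>] s by (intro frac_le) auto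
  then show ?thesis
    unfolding gam_eq by linarith
qed

lemma continuous_on_w [continuous_intros]:
  fixes f :: "'a::t2_space \<Rightarrow> real"
  shows "continuous_on A f \<Longrightarrow> continuous_on A (\<lambda>x. w (f x))"
  unfolding w_def by (intro continuous_intros)

lemma continuous_on_gam [continuous_intros]:
  fixes f :: "'a::t2_space \<Rightarrow> real"
  shows "continuous_on A f \<Longrightarrow> continuous_on A (\<lambda>x. gam \<xi> (f x))"
  unfolding gam_eq by (intro continuous_intros) auto

section \<open>The kernel and its image under \<open>E\<close>\<close>

definition k where "k r = integral {0..pi} (\<lambda>\<theta>. exp (- (gam \<xi> \<theta> * r)) / w \<theta>)" for r

text \<open>This is \<open>E k\<close>: the operator \<open>E = D + 1/2\<close> multiplies
  \<open>exp (- \<gamma> r)\<close> by \<open>1/2 - \<gamma> r\<close>.\<close>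

definition e where "e r = integral {0..pi} (\<lambda>\<theta>. (1 / 2 - gam \<xi> \<theta> * r) * exp (- (gam \<xi> \<theta> * r)) / w \<theta>)" for r

lemma k_ode: "euler_ode (- 1 / 2) k e"
  unfolding euler_ode_def
proof (intro allI impI)
  fix r :: real assume r: "0 < r"
  have "((\<lambda>r. integral (cbox 0 pi) (\<lambda>\<theta>. exp (- (gam \<xi> \<theta> * r)) / w \<theta>)) has_field_derivative
      integral (cbox 0 pi) (\<lambda>\<theta>. - gam \<xi> \<theta> * exp (- (gam \<xi> \<theta> * r)) / w \<theta>)) (at r within UNIV)"
  proof (rule leibniz_rule_field_derivative)
    show "((\<lambda>x. exp (- (gam \<xi> t * x)) / w t) has_real_derivative
        - gam \<xi> t * exp (- (gam \<xi> t * x)) / w t) (at x within UNIV)" for x t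
      by (auto intro!: derivative_eq_intros)
    show "(\<lambda>\<theta>. exp (- (gam \<xi> \<theta> * x)) / w \<theta>) integrable_on cbox 0 pi" for x
      by (intro integrable_continuous continuous_intros) auto
    show "continuous_on (UNIV \<times> cbox 0 pi) (\<lambda>(x, t). - gam \<xi> t * exp (- (gam \<xi> t * x)) / w t)"
      unfolding split_beta by (intro continuous_intros) auto
  qed auto
  then have d: "(k has_real_derivative integral {0..pi} (\<lambda>\<theta>. - gam \<xi> \<theta> * exp (- (gam \<xi> \<theta> * r)) / w \<theta>)) (at r)"
    by (simp add: k_def[abs_def])
  have "((\<lambda>\<theta>. - 1 / 2 * (exp (- (gam \<xi> \<theta> * r)) / w \<theta>) +
      (1 / 2 - gam \<xi> \<theta> * r) * exp (- (gam \<xi> \<theta> * r)) / w \<theta>) has_integral (- 1 / 2 * k r + e r)) {0..pi}"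
    unfolding k_def e_def
    by (intro has_integral_add has_integral_mult_right integrable_integral integrable_continuous_real
          continuous_intros) auto
  then have "((\<lambda>\<theta>. (- 1 / 2 * (exp (- (gam \<xi> \<theta> * r)) / w \<theta>) +
      (1 / 2 - gam \<xi> \<theta> * r) * exp (- (gam \<xi> \<theta> * r)) / w \<theta>) / r) has_integral (- 1 / 2 * k r + e r) / r) {0..pi}"
    by (rule has_integral_divide)
  also have "(\<lambda>\<theta>. (- 1 / 2 * (exp (- (gam \<xi> \<theta> * r)) / w \<theta>) +
      (1 / 2 - gam \<xi> \<theta> * r) * exp (- (gam \<xi> \<theta> * r)) / w \<theta>) / r) =
      (\<lambda>\<theta>. - gam \<xi> \<theta> * exp (- (gam \<xi> \<theta> * r)) / w \<theta>)"
    using r by (auto simp: field_simps)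
  finally have "integral {0..pi} (\<lambda>\<theta>. - gam \<xi> \<theta> * exp (- (gam \<xi> \<theta> * r)) / w \<theta>) = (- 1 / 2 * k r + e r) / r"
    by (rule integral_unique)
  with d show "(k has_real_derivative (- 1 / 2 * k r + e r) / r) (at r)"
    by simp
qed

definition b where "b \<theta> r = (1 - \<xi>) / 2 * (1 / (w \<theta>) ^ 2 - r / (w \<theta>) ^ 3) * exp (- (gam \<xi> \<theta> * r))" for \<theta> r

lemma continuous_on_b: "continuous_on A (\<lambda>\<theta>. b \<theta> r)"
  unfolding b_def by (intro continuous_intros) auto

text \<open>
  Integration by parts against \<open>s sin \<theta> / (2 w \<theta>)\<close>, which vanishes at both endpoints, leaves an
  integrand with the small factor \<open>1 - \<xi>\<close>.
\<close>

lemma e_eq: "e r = integral {0..pi} (\<lambda>\<theta>. b \<theta> r)"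
proof -
  define h where "h \<theta> = s * sin \<theta> / (2 * w \<theta>) * exp (- (gam \<xi> \<theta> * r))" for \<theta>
  define i where "i \<theta> = (1 / 2 - gam \<xi> \<theta> * r) * exp (- (gam \<xi> \<theta> * r)) / w \<theta> - b \<theta> r" for \<theta>
  have "(i has_integral (h pi - h 0)) {0..pi}"
  proof (rule fundamental_theorem_of_calculus)
    fix \<theta> :: real
    have dw: "(w has_real_derivative - s * sin \<theta>) (at \<theta>)"
      unfolding w_def[abs_def] by (auto intro!: derivative_eq_intros)
    have dg: "(gam \<xi> has_real_derivative s * sin \<theta> / (w \<theta>)\<^sup>2) (at \<theta>)"
      unfolding gam_eq[abs_def]
      by (auto intro!: derivative_eq_intros dw simp: field_simps power2_eq_square)
    have "(h has_real_derivative
        ((s * cos \<theta> * (2 * w \<theta>) - s * sin \<theta> * (2 * (- s * sin \<theta>))) / (2 * w \<theta>)\<^sup>2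
          - s * sin \<theta> / (2 * w \<theta>) * (s * sin \<theta> / (w \<theta>)\<^sup>2 * r)) * exp (- (gam \<xi> \<theta> * r))) (at \<theta>)"
      unfolding h_def[abs_def]
      by (auto intro!: derivative_eq_intros dw dg simp: field_simps power2_eq_square)
    also have "((s * cos \<theta> * (2 * w \<theta>) - s * sin \<theta> * (2 * (- s * sin \<theta>))) / (2 * w \<theta>)\<^sup>2
          - s * sin \<theta> / (2 * w \<theta>) * (s * sin \<theta> / (w \<theta>)\<^sup>2 * r)) =
        (1 / 2 - gam \<xi> \<theta> * r) / w \<theta> - (1 - \<xi>) / 2 * (1 / (w \<theta>) ^ 2 - r / (w \<theta>) ^ 3)"
    proof -
      \<comment> \<open>With \<open>s cos \<theta> = W - 1\<close> and
        \<open>(s sin \<theta>)^2 = \<xi> - (W - 1)^2\<close> the trigonometric identity becomes a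
        rational one in \<open>W\<close>.\<close>
      define W where "W = w \<theta>"
      have W: "W \<noteq> 0" by (simp add: W_def)
      have c: "s * cos \<theta> = W - 1"
        by (simp add: W_def w_def)
      define Z where "Z = s * sin \<theta>"
      have "Z\<^sup>2 = \<xi> - (s * cos \<theta>)\<^sup>2"
        by (simp add: Z_def power_mult_distrib sin_squared_eq s algebra_simps)
      then have Z2: "Z * Z = \<xi> - (W - 1)\<^sup>2"
        unfolding c by (simp add: power2_eq_square)
      have "((W - 1) * (2 * W) - Z * (2 * (- Z))) / (2 * W)\<^sup>2 - Z / (2 * W) * (Z / W\<^sup>2 * r)
         = ((W - 1) * (2 * W) + 2 * (Z * Z)) / (2 * W)\<^sup>2 - (Z * Z) * r / (2 * W ^ 3)"
        by (simp add: power2_eq_square power3_eq_cube mult_ac)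
      also have "\<dots> = (1 / 2 - 1 / 2 * ((2 - W) / W) * r) / W - (1 - \<xi>) / 2 * (1 / W ^ 2 - r / W ^ 3)"
        unfolding Z2 using W by (simp add: field_simps power2_eq_square power3_eq_cube)
      finally show ?thesis
        unfolding c[symmetric] by (simp add: W_def Z_def gam_eq mult.assoc)
    qed
    also have "((1 / 2 - gam \<xi> \<theta> * r) / w \<theta> - (1 - \<xi>) / 2 * (1 / (w \<theta>) ^ 2 - r / (w \<theta>) ^ 3)) * exp (- (gam \<xi> \<theta> * r))
        = i \<theta>"
      by (simp add: i_def b_def left_diff_distrib)
    finally show "(h has_vector_derivative i \<theta>) (at \<theta> within {0..pi})"
      by (simp add: has_real_derivative_iff_has_vector_derivative has_vector_derivative_at_within)
  qed simp
  then have i0: "(i has_integral 0) {0..pi}"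
    by (simp add: h_def)
  have "(i has_integral (e r - integral {0..pi} (\<lambda>\<theta>. b \<theta> r))) {0..pi}"
    unfolding i_def[abs_def] e_def
    by (intro has_integral_diff integrable_integral integrable_continuous_real continuous_on_b
          continuous_intros) auto
  from has_integral_unique[OF i0 this] show ?thesis
    by simp
qed

text \<open>A weight on [0, pi] of mass pi for every \<open>\<xi>\<close>, peaked at both ends as
  \<open>\<xi>\<close> tends to 1. It is chosen to follow the size of \<open>b\<close>: the integral
  of \<open>b^2\<close> over \<open>r\<close> is at most a constant times
  \<open>m^2\<close>.\<close>

definition m where "m \<theta> = sqrt (1 - \<xi>) / (1 - \<xi> * (cos \<theta>)\<^sup>2)" for \<theta>

lemma w_wbar: "w \<theta> * (2 - w \<theta>) = 1 - \<xi> * (cos \<theta>)\<^sup>2"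
proof -
  have "w \<theta> * (2 - w \<theta>) = 1 - (s * cos \<theta>)\<^sup>2"
    by (simp add: w_def algebra_simps power2_eq_square)
  then show ?thesis
    by (simp add: power_mult_distrib s(3))
qed

lemma denom_pos: "0 < 1 - \<xi> * (cos \<theta>)\<^sup>2"
  unfolding w_wbar[symmetric] using w_bounds(3) wbar_bounds(3) by simp

lemma m_pos: "0 < m \<theta>"
  using xi denom_pos by (simp add: m_def)

lemma continuous_on_m: "continuous_on A m"
proof -
  have "1 - \<xi> * (cos \<theta>)\<^sup>2 \<noteq> 0" for \<theta>
    using denom_pos[of \<theta>] by simp
  then show ?thesis
    unfolding m_def[abs_def] by (intro continuous_intros) auto
qed

text \<open>The familiar antiderivative \<open>arctan (tan \<theta> / sqrt (1 - \<xi>))\<close>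
  jumps at pi/2. The form \<open>arccos (v \<theta>)\<close> represents the same angle continuously
  on all of [0, pi], running from 0 to pi.\<close>

lemma has_integral_m: "(m has_integral pi) {0..pi}"
proof -
  define S where "S \<theta> = 1 - \<xi> * (cos \<theta>)\<^sup>2" for \<theta>
  define v where "v \<theta> = sqrt (1 - \<xi>) * cos \<theta> / sqrt (S \<theta>)" for \<theta>
  have S: "0 < S \<theta>" for \<theta>
    using denom_pos by (simp add: S_def)
  have v2: "1 - (v \<theta>)\<^sup>2 = (sin \<theta>)\<^sup>2 / S \<theta>" for \<theta>
  proof -
    have "1 - (v \<theta>)\<^sup>2 = (S \<theta> - (1 - \<xi>) * (cos \<theta>)\<^sup>2) / S \<theta>"
      using S[of \<theta>] xi by (simp add: v_def power_mult_distrib power_divide diff_divide_distrib)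
    also have "S \<theta> - (1 - \<xi>) * (cos \<theta>)\<^sup>2 = (sin \<theta>)\<^sup>2"
      by (simp add: S_def sin_squared_eq algebra_simps)
    finally show ?thesis .
  qed
  have v_le: "\<bar>v \<theta>\<bar> \<le> 1" for \<theta>
  proof -
    have "0 \<le> 1 - (v \<theta>)\<^sup>2"
      unfolding v2 using S[of \<theta>] by simp
    then show ?thesis
      by (simp add: abs_square_le_1)
  qed
  have contv: "continuous_on {0..pi} v"
  proof -
    have "sqrt (S \<theta>) \<noteq> 0" for \<theta>
      using S[of \<theta>] by simp
    moreover have "continuous_on {0..pi} S"
      unfolding S_def[abs_def] by (intro continuous_intros)
    ultimately show ?thesis
      unfolding v_def[abs_def] by (intro continuous_intros) blast+
  qed
  have "(m has_integral (arccos (v pi) - arccos (v 0))) {0..pi}"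
  \<comment> \<open>At the endpoints \<open>v\<close> equals 1 and -1, where \<open>arccos\<close>
    is continuous but not differentiable.\<close>
  proof (rule fundamental_theorem_of_calculus_interior)
    show "continuous_on {0..pi} (\<lambda>\<theta>. arccos (v \<theta>))"
    proof (intro continuous_on_arccos contv ballI)
      show "- 1 \<le> v \<theta> \<and> v \<theta> \<le> 1" for \<theta>
        using v_le[of \<theta>] by linarith
    qed
    fix \<theta> :: real assume t: "\<theta> \<in> {0<..<pi}"
    then have sin: "0 < sin \<theta>"
      by (simp add: sin_gt_zero)
    have "0 < 1 - (v \<theta>)\<^sup>2"
      unfolding v2 using S[of \<theta>] sin by simp
    then have "\<bar>v \<theta>\<bar> < 1"
      by (simp add: abs_square_less_1)
    then have v1: "- 1 < v \<theta>" "v \<theta> < 1"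
      by auto
    have dS: "(S has_real_derivative 2 * \<xi> * cos \<theta> * sin \<theta>) (at \<theta>)"
      unfolding S_def[abs_def] by (auto intro!: derivative_eq_intros)
    have "(v has_real_derivative
        (- sqrt (1 - \<xi>) * sin \<theta> * sqrt (S \<theta>) -
           sqrt (1 - \<xi>) * cos \<theta> * (2 * \<xi> * cos \<theta> * sin \<theta> * (inverse (sqrt (S \<theta>)) / 2))) / (sqrt (S \<theta>) * sqrt (S \<theta>))) (at \<theta>)"
      unfolding v_def[abs_def] using S[of \<theta>]
      by (auto intro!: derivative_eq_intros dS simp: mult_ac)
    also have "(- sqrt (1 - \<xi>) * sin \<theta> * sqrt (S \<theta>) -
           sqrt (1 - \<xi>) * cos \<theta> * (2 * \<xi> * cos \<theta> * sin \<theta> * (inverse (sqrt (S \<theta>)) / 2))) / (sqrt (S \<theta>) * sqrt (S \<theta>))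
        = - sqrt (1 - \<xi>) * sin \<theta> / (S \<theta> * sqrt (S \<theta>))"
    proof -
      define q where "q = sqrt (S \<theta>)"
      have q: "q \<noteq> 0" "q * q = S \<theta>"
        using S[of \<theta>] by (auto simp: q_def)
      have "(- sqrt (1 - \<xi>) * sin \<theta> * q -
           sqrt (1 - \<xi>) * cos \<theta> * (2 * \<xi> * cos \<theta> * sin \<theta> * (inverse q / 2))) / (q * q) =
          - sqrt (1 - \<xi>) * sin \<theta> * (q * q + \<xi> * (cos \<theta>)\<^sup>2) / (q * q * q)"
        using q(1) by (simp add: field_simps power2_eq_square)
      also have "q * q + \<xi> * (cos \<theta>)\<^sup>2 = 1"
        by (simp add: q S_def)
      finally show ?thesis
        unfolding q_def[symmetric] by (simp add: q(2))
    qed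
    finally have dv: "(v has_real_derivative - sqrt (1 - \<xi>) * sin \<theta> / (S \<theta> * sqrt (S \<theta>))) (at \<theta>)" .
    have "((\<lambda>\<theta>. arccos (v \<theta>)) has_real_derivative
        inverse (- sqrt (1 - (v \<theta>)\<^sup>2)) * (- sqrt (1 - \<xi>) * sin \<theta> / (S \<theta> * sqrt (S \<theta>)))) (at \<theta>)"
      by (rule DERIV_chain2[OF DERIV_arccos[OF v1] dv])
    also have "inverse (- sqrt (1 - (v \<theta>)\<^sup>2)) * (- sqrt (1 - \<xi>) * sin \<theta> / (S \<theta> * sqrt (S \<theta>))) = m \<theta>"
      unfolding v2 using S[of \<theta>] sin
      by (simp add: m_def S_def[symmetric] real_sqrt_divide field_simps)
    finally show "((\<lambda>\<theta>. arccos (v \<theta>)) has_vector_derivative m \<theta>) (at \<theta>)"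
      by (simp add: has_real_derivative_iff_has_vector_derivative)
  qed simp
  moreover have "v pi = - 1" "v 0 = 1"
    using xi by (simp_all add: v_def S_def)
  ultimately show ?thesis
    by simp
qed

end

section \<open>A bound on the norm of \<open>E k\<close> that is uniform in
  \<open>\<xi>\<close>\<close>

context four_partite
begin

text \<open>After \<open>(x - y)^2 \<le> 2 x^2 + 2 y^2\<close> the integral over \<open>r\<close> is
  explicit, with rate \<open>l = 2 \<gamma>(\<theta>)\<close>. It collapses to powers of
  \<open>W V = 1 - \<xi> cos^2 \<theta>\<close>, the denominator of \<open>m\<close>.\<close>

lemma nn_integral_b:
  "(\<integral>\<^sup>+ r\<in>{0<..}. ennreal ((b \<theta> r)\<^sup>2 / m \<theta>) \<partial>lborel) \<le> ennreal (3 * m \<theta>)"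
proof -
  define W V l where "W = w \<theta>" and "V = 2 - w \<theta>" and "l = V / W"
  have W: "0 < W" "W \<le> 2" and V: "0 < V" "V \<le> 2"
    using w_bounds[of \<theta>] wbar_bounds[of \<theta>] by (auto simp: W_def V_def)
  define S where "S = 1 - \<xi> * (cos \<theta>)\<^sup>2"
  have S: "W * V = S" "0 < S"
    using w_wbar[of \<theta>] denom_pos[of \<theta>] by (auto simp: W_def V_def S_def)
  have l: "0 < l" using W V by (simp add: l_def)
  define d where "d = 1 - \<xi>"
  have d: "0 < d" using xi by (simp add: d_def)
  have dS: "d \<le> S"
    using xi mult_left_mono[OF abs_square_le_1[THEN iffD2, OF abs_cos_le_one[of \<theta>]], of \<xi>]
    by (simp add: d_def S_def)
  have m: "m \<theta> = sqrt d / S"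
    by (simp add: m_def d_def S_def)
  define A B where "A = d\<^sup>2 / 2 / W ^ 4 / m \<theta>" and "B = d\<^sup>2 / 2 / W ^ 6 / m \<theta>"
  have AB: "0 \<le> A" "0 \<le> B"
    using W m_pos[of \<theta>] by (auto simp: A_def B_def)
  have "(b \<theta> r)\<^sup>2 / m \<theta> \<le> (A + B * r\<^sup>2) * exp (- (l * r))" for r
  proof -
    have "(exp (- (gam \<xi> \<theta> * r)))\<^sup>2 = exp (- (l * r))"
      by (simp add: power2_eq_square exp_add[symmetric] gam_eq l_def W_def V_def)
    then have "(b \<theta> r)\<^sup>2 = d\<^sup>2 / 4 * (1 / W ^ 2 - r / W ^ 3)\<^sup>2 * exp (- (l * r))"
      by (simp add: b_def d_def W_def power_mult_distrib power_divide)
    also have "(1 / W ^ 2 - r / W ^ 3)\<^sup>2 \<le> 2 * (1 / W ^ 2)\<^sup>2 + 2 * (r / W ^ 3)\<^sup>2"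
      using zero_le_power2[of "1 / W ^ 2 + r / W ^ 3"] by (simp add: power2_diff power2_sum)
    also have "2 * (1 / W ^ 2)\<^sup>2 + 2 * (r / W ^ 3)\<^sup>2 = 2 * (1 / W ^ 4 + r\<^sup>2 / W ^ 6)"
      by (simp add: power_divide power_mult[symmetric])
    finally have "(b \<theta> r)\<^sup>2 \<le> d\<^sup>2 / 4 * (2 * (1 / W ^ 4 + r\<^sup>2 / W ^ 6)) * exp (- (l * r))"
      by (simp add: mult_left_mono mult_right_mono)
    then have "(b \<theta> r)\<^sup>2 / m \<theta> \<le> d\<^sup>2 / 4 * (2 * (1 / W ^ 4 + r\<^sup>2 / W ^ 6)) * exp (- (l * r)) / m \<theta>"
      using m_pos[of \<theta>] by (intro divide_right_mono) auto
    also have "\<dots> = (A + B * r\<^sup>2) * exp (- (l * r))"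
      by (simp add: A_def B_def algebra_simps add_divide_distrib)
    finally show ?thesis .
  qed
  then have "(\<integral>\<^sup>+ r\<in>{0<..}. ennreal ((b \<theta> r)\<^sup>2 / m \<theta>) \<partial>lborel)
      \<le> (\<integral>\<^sup>+ r\<in>{0<..}. ennreal ((A + B * r\<^sup>2) * exp (- (l * r))) \<partial>lborel)"
    by (intro nn_integral_mono mult_right_mono ennreal_leI) auto
  also have "\<dots> = ennreal (A / l + 2 * B / l ^ 3)"
    by (rule nn_integral_exp_quadratic[OF l AB])
  also have "A / l + 2 * B / l ^ 3 \<le> 3 * m \<theta>"
  proof -
    have "A / l + 2 * B / l ^ 3 = d\<^sup>2 / 2 * (V\<^sup>2 + 2) / (W * V) ^ 3 / m \<theta>"
      using W V m_pos[of \<theta>]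
      by (simp add: A_def B_def l_def field_simps power2_eq_square power3_eq_cube eval_nat_numeral)
    \<comment> \<open>From \<open>V \<le> 2\<close> comes the constant
      \<open>(2^2 + 2) / 2 = 3\<close>. What remains equals \<open>3 m (d / S)\<close>, and
      \<open>d \<le> S\<close>.\<close>
    also have "\<dots> \<le> d\<^sup>2 / 2 * (2\<^sup>2 + 2) / (W * V) ^ 3 / m \<theta>"
      using W V m_pos[of \<theta>]
      by (intro divide_right_mono mult_left_mono add_right_mono power_mono) auto
    also have "\<dots> = 3 * m \<theta> * (d / S)"
    proof -
      have "sqrt d * sqrt d = d" "sqrt d \<noteq> 0" using d by auto
      then show ?thesis
        unfolding S(1) m using S(2) by (simp add: field_simps power2_eq_square power3_eq_cube)
    qed
    also have "\<dots> \<le> 3 * m \<theta> * 1"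
      using dS S(2) m_pos[of \<theta>] by (intro mult_left_mono) auto
    finally show ?thesis by simp
  qed
  finally show ?thesis
    by (simp add: ennreal_leI)
qed

lemma b_measurable:
  shows "(\<lambda>(\<theta>, r). ennreal ((b \<theta> r)\<^sup>2 / m \<theta>) * indicator {0..pi} \<theta> * indicator {0<..} r)
    \<in> borel_measurable (lborel \<Otimes>\<^sub>M lborel)"
  and "(\<lambda>(r, \<theta>). ennreal ((b \<theta> r)\<^sup>2 / m \<theta>) * indicator {0..pi} \<theta> * indicator {0<..} r)
    \<in> borel_measurable (lborel \<Otimes>\<^sub>M lborel)"
  unfolding b_def m_def gam_eq w_def by measurable

text \<open>Cauchy-Schwarz with weight \<open>m\<close> costs a factor pi, the mass of
  \<open>m\<close>. Exchanging the integrals and using the pointwise bound \<open>3 m\<close> then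
  gives \<open>3 pi\<close>, again by the mass of \<open>m\<close>.\<close>

lemma e_nn_integral: "(\<integral>\<^sup>+ r\<in>{0<..}. ennreal ((e r)\<^sup>2) \<partial>lborel) \<le> ennreal (3 * pi\<^sup>2)"
proof -
  have cb: "continuous_on {0..pi} (\<lambda>\<theta>. (b \<theta> r)\<^sup>2 / m \<theta>)" for r
    using m_pos by (intro continuous_intros continuous_on_b continuous_on_m) (metis less_irrefl)
  have "ennreal ((e r)\<^sup>2) \<le> ennreal pi * (\<integral>\<^sup>+ \<theta>\<in>{0..pi}. ennreal ((b \<theta> r)\<^sup>2 / m \<theta>) \<partial>lborel)" for r
  proof -
    have "(e r)\<^sup>2 \<le> pi * integral {0..pi} (\<lambda>\<theta>. (b \<theta> r)\<^sup>2 / m \<theta>)"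
      using integral_weighted_Cauchy_Schwarz[OF continuous_on_b[of _ r] continuous_on_m m_pos pi_gt_zero]
      unfolding e_eq integral_unique[OF has_integral_m] .
    then have "ennreal ((e r)\<^sup>2) \<le> ennreal (pi * integral {0..pi} (\<lambda>\<theta>. (b \<theta> r)\<^sup>2 / m \<theta>))"
      by (rule ennreal_leI)
    also have "\<dots> = ennreal pi * (\<integral>\<^sup>+ \<theta>\<in>{0..pi}. ennreal ((b \<theta> r)\<^sup>2 / m \<theta>) \<partial>lborel)"
      using m_pos by (subst nn_integral_continuous_Icc[OF cb])
        (auto intro!: ennreal_mult integral_nonneg integrable_continuous_real cb divide_nonneg_pos)
    finally show ?thesis .
  qed
  then have "(\<integral>\<^sup>+ r\<in>{0<..}. ennreal ((e r)\<^sup>2) \<partial>lborel) \<le>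
      (\<integral>\<^sup>+ r\<in>{0<..}. ennreal pi * (\<integral>\<^sup>+ \<theta>\<in>{0..pi}. ennreal ((b \<theta> r)\<^sup>2 / m \<theta>) \<partial>lborel) \<partial>lborel)"
    by (intro nn_integral_mono mult_right_mono) auto
  also have "\<dots> = (\<integral>\<^sup>+ r. ennreal pi *
      (\<integral>\<^sup>+ \<theta>. ennreal ((b \<theta> r)\<^sup>2 / m \<theta>) * indicator {0..pi} \<theta> * indicator {0<..} r \<partial>lborel) \<partial>lborel)"
    by (intro nn_integral_cong) (auto simp: indicator_def)
  also have "\<dots> = ennreal pi * (\<integral>\<^sup>+ r. \<integral>\<^sup>+ \<theta>. ennreal ((b \<theta> r)\<^sup>2 / m \<theta>) * indicator {0..pi} \<theta> * indicator {0<..} r \<partial>lborel \<partial>lborel)"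
    by (intro nn_integral_cmult lborel.borel_measurable_nn_integral b_measurable(2))
  also have "(\<integral>\<^sup>+ r. \<integral>\<^sup>+ \<theta>. ennreal ((b \<theta> r)\<^sup>2 / m \<theta>) * indicator {0..pi} \<theta> * indicator {0<..} r \<partial>lborel \<partial>lborel)
      = (\<integral>\<^sup>+ \<theta>. \<integral>\<^sup>+ r. ennreal ((b \<theta> r)\<^sup>2 / m \<theta>) * indicator {0..pi} \<theta> * indicator {0<..} r \<partial>lborel \<partial>lborel)"
    using lborel_pair.Fubini'[OF b_measurable(1)] by simp
  also have "\<dots> \<le> (\<integral>\<^sup>+ \<theta>\<in>{0..pi}. ennreal (3 * m \<theta>) \<partial>lborel)"
  proof (intro nn_integral_mono)
    fix \<theta>
    show "(\<integral>\<^sup>+ r. ennreal ((b \<theta> r)\<^sup>2 / m \<theta>) * indicator {0..pi} \<theta> * indicator {0<..} r \<partial>lborel)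
        \<le> ennreal (3 * m \<theta>) * indicator {0..pi} \<theta>"
      using nn_integral_b[of \<theta>] by (cases "\<theta> \<in> {0..pi}") simp_all
  qed
  also have "\<dots> = ennreal (integral {0..pi} (\<lambda>\<theta>. 3 * m \<theta>))"
    using m_pos by (intro nn_integral_continuous_Icc continuous_intros continuous_on_m) (simp add: less_imp_le)
  also have "integral {0..pi} (\<lambda>\<theta>. 3 * m \<theta>) = 3 * pi"
    by (simp add: integral_unique[OF has_integral_m])
  also have "ennreal pi * ennreal (3 * pi) = ennreal (3 * pi\<^sup>2)"
    by (subst ennreal_mult[symmetric]) (auto simp: power2_eq_square)
  finally show ?thesis
    by (simp add: mult_left_mono)
qed

lemma e_square_integrable: "square_integrable e"
  using e_nn_integral
  by (intro square_integrable_nn_integral euler_ode_measurable[OF k_ode])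
    (auto intro: le_less_trans simp: less_top)

lemma e_norm: "L2norm e \<le> 6"
proof -
  have "ennreal ((L2norm e)\<^sup>2) \<le> ennreal (3 * pi\<^sup>2)"
    using e_nn_integral unfolding nn_integral_square_integrable[OF e_square_integrable] .
  then have "(L2norm e)\<^sup>2 \<le> 3 * pi\<^sup>2"
    by (subst (asm) ennreal_le_iff) auto
  also have "\<dots> \<le> 3 * (3.2)\<^sup>2"
    using pi_approx by (intro mult_left_mono power_mono) auto
  also have "\<dots> \<le> 6\<^sup>2"
    by (simp add: power2_eq_square)
  finally show ?thesis
    by (rule power2_le_imp_le) simp
qed

section \<open>Decay and growth of the norm of the kernel\<close>

lemma kernel_continuous: "continuous_on {0..pi} (\<lambda>\<theta>. exp (- (gam \<xi> \<theta> * r)) / w \<theta>)"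
  by (intro continuous_intros) auto

lemma k_bounds:
  assumes r: "0 < r"
  shows "0 < k r" "k r \<le> pi / (1 - s) * exp (- ((1 - s) / 4 * r))"
proof -
  have nn: "0 < exp (- (gam \<xi> \<theta> * r)) / w \<theta>" for \<theta>
    using w_bounds(3)[of \<theta>] by simp
  have "0 \<le> k r"
    unfolding k_def by (intro integral_nonneg integrable_continuous_real kernel_continuous less_imp_le[OF nn])
  moreover have "k r \<noteq> 0"
    using integral_eq_0_iff[OF kernel_continuous pi_gt_zero, of r] nn
    by (auto simp: k_def less_imp_le intro!: bexI[of _ 0])
  ultimately show "0 < k r" by simp
  have "k r \<le> integral {0..pi} (\<lambda>\<theta>. exp (- ((1 - s) / 4 * r)) / (1 - s))"
    unfolding k_def
  proof (intro integral_le integrable_continuous_real kernel_continuous continuous_intros)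
    fix \<theta> :: real
    show "exp (- (gam \<xi> \<theta> * r)) / w \<theta> \<le> exp (- ((1 - s) / 4 * r)) / (1 - s)"
      using w_bounds[of \<theta>] s r mult_right_mono[OF gam_lower[of \<theta>], of r]
      by (intro frac_le) auto
  qed
  then show "k r \<le> pi / (1 - s) * exp (- ((1 - s) / 4 * r))"
    by simp
qed

lemma k_square_integrable: "square_integrable k"
proof -
  define A where "A = pi / (1 - s)"
  have cont: "continuous_on {0<..} k"
    by (rule euler_ode_continuous_on[OF k_ode])
  have "set_integrable lborel {0<..} (\<lambda>r. (k r)\<^sup>2)"
  proof (rule set_integrable_exp_bounded)
    show "continuous_on {0<..} (\<lambda>r. (k r)\<^sup>2)"
      by (intro continuous_intros cont)
    show "0 < (1 - s) / 2" using s by simp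
    fix r :: real assume r: "0 < r"
    have "(k r)\<^sup>2 \<le> (A * exp (- ((1 - s) / 4 * r)))\<^sup>2"
      using k_bounds[OF r] by (intro power_mono) (auto simp: A_def)
    also have "\<dots> = A\<^sup>2 * exp (- ((1 - s) / 2 * r))"
      by (simp add: power2_eq_square exp_add[symmetric] field_simps)
    finally show "\<bar>(k r)\<^sup>2\<bar> \<le> A\<^sup>2 * exp (- ((1 - s) / 2 * r))" by simp
  qed simp
  then show ?thesis
    using set_measurable_continuous_on[OF _ cont]
    by (simp add: square_integrable_def set_borel_measurable_def)
qed

lemma k_tendsto_0: "(k \<longlongrightarrow> 0) at_top"
proof (rule Lim_null_comparison)
  show "\<forall>\<^sub>F r in at_top. norm (k r) \<le> pi / (1 - s) * exp (- ((1 - s) / 4 * r))"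
    using k_bounds by (intro eventually_mono[OF eventually_gt_at_top[of 0]]) (simp add: less_imp_le)
  have "0 < (1 - s) / 4" using s by simp
  then have "((\<lambda>r. c * exp (- ((1 - s) / 4 * r))) \<longlongrightarrow> 0) at_top" for c
    by real_asymp
  then show "((\<lambda>r. pi / (1 - s) * exp (- ((1 - s) / 4 * r))) \<longlongrightarrow> 0) at_top" .
qed

text \<open>Only angles up to \<open>1 / sqrt r\<close> are used. There \<open>2 - w\<close> is at
  most \<open>(1 - s) + 1 / (2 r)\<close>, so \<open>\<gamma>(\<theta>) r\<close> stays below 1 as
  long as \<open>r \<le> 1 / (1 - s)\<close>; the length of this range of angles is the profile
  \<open>r powr (- 1/2)\<close>.\<close>

lemma k_lower_bound:
  assumes r: "1 \<le> r" "r \<le> 1 / (1 - s)"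
  shows "1 / (2 * exp 1 * sqrt r) \<le> k r"
proof -
  define x where "x = 1 / sqrt r"
  have x: "0 < x" "x \<le> 1" "x\<^sup>2 * r = 1"
    using r by (auto simp: x_def power_divide)
  have sub: "{0..x} \<subseteq> {0..pi}"
    using x pi_gt3 by auto
  have "1 / (2 * exp 1 * sqrt r) = integral {0..x} (\<lambda>\<theta>. exp (- 1) / 2)"
    using x by (simp add: x_def exp_minus field_simps)
  also have "\<dots> \<le> integral {0..x} (\<lambda>\<theta>. exp (- (gam \<xi> \<theta> * r)) / w \<theta>)"
  proof (intro integral_le integrable_continuous_real continuous_on_subset[OF kernel_continuous sub])
    fix \<theta> assume t: "\<theta> \<in> {0..x}"
    have "1 - cos \<theta> \<le> x\<^sup>2 / 2"
    proof -
      have "\<theta>\<^sup>2 \<le> x\<^sup>2"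
        using t by (intro power_mono) auto
      then show ?thesis
        using one_minus_cos_le[of \<theta>] by linarith
    qed
    moreover have "s * (1 - cos \<theta>) \<le> 1 * (1 - cos \<theta>)"
      using s by (intro mult_right_mono) auto
    ultimately have "2 - w \<theta> \<le> (1 - s) + x\<^sup>2 / 2"
      by (simp add: w_def algebra_simps)
    then have "(2 - w \<theta>) * r \<le> ((1 - s) + x\<^sup>2 / 2) * r"
      using r by (intro mult_right_mono) auto
    also have "\<dots> = (1 - s) * r + 1 / 2"
      using x(3) by (simp add: algebra_simps)
    also have "(1 - s) * r \<le> 1"
      using r s by (simp add: field_simps)
    finally have 1: "(2 - w \<theta>) * r \<le> 3 / 2" by simp
    have "cos \<theta> \<ge> 1 / 2"
      using \<open>1 - cos \<theta> \<le> x\<^sup>2 / 2\<close> x power_mono[of x 1 2] by auto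
    then have w1: "1 \<le> w \<theta>"
      using s by (simp add: w_def)
    have "gam \<xi> \<theta> * r = 1 / 2 * ((2 - w \<theta>) * r / w \<theta>)"
      by (simp add: gam_eq)
    also have "(2 - w \<theta>) * r / w \<theta> \<le> (3 / 2) / 1"
      using 1 w1 by (intro frac_le) auto
    finally have "gam \<xi> \<theta> * r \<le> 1" by simp
    then show "exp (- 1) / 2 \<le> exp (- (gam \<xi> \<theta> * r)) / w \<theta>"
      using w_bounds[of \<theta>] by (intro frac_le) auto
  qed auto
  also have "\<dots> \<le> k r"
    unfolding k_def using w_bounds(3)
    by (intro integral_subset_le sub integrable_continuous_real kernel_continuous
          continuous_on_subset[OF kernel_continuous sub]) (auto intro: divide_nonneg_pos)
  finally show ?thesis .
qed

text \<open>The square of the profile is a multiple of \<open>1 / r\<close>, whose integral over the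
  range from 1 to \<open>1 / (1 - s)\<close> is the logarithm that diverges as \<open>\<xi>\<close>
  tends to 1.\<close>

lemma k_norm_lower_bound: "sqrt (ln (1 / (1 - s))) / (2 * exp 1) \<le> L2norm k"
proof (rule power2_le_imp_le)
  define R where "R = 1 / (1 - s)"
  have R: "1 \<le> R"
    using s by (simp add: R_def)
  have i: "((\<lambda>r. 1 / (2 * exp 1)\<^sup>2 * (1 / r)) has_integral (1 / (2 * exp 1)\<^sup>2 * (ln R - ln 1))) {1..R}"
    using R by (intro has_integral_mult_right fundamental_theorem_of_calculus)
      (auto intro!: derivative_eq_intros simp flip: has_real_derivative_iff_has_vector_derivative)
  have "(sqrt (ln (1 / (1 - s))) / (2 * exp 1))\<^sup>2 = 1 / (2 * exp 1)\<^sup>2 * (ln R - ln 1)"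
    using R by (simp add: R_def[symmetric] power_divide)
  also have "\<dots> = integral {1..R} (\<lambda>r. 1 / (2 * exp 1)\<^sup>2 * (1 / r))"
    using i by (simp add: integral_unique)
  also have "\<dots> \<le> integral {1..R} (\<lambda>r. (k r)\<^sup>2)"
  proof (intro integral_le has_integral_integrable[OF i] square_integrable_on_Icc(1)[OF k_square_integrable])
    fix r assume r: "r \<in> {1..R}"
    have "(1 / (2 * exp 1 * sqrt r))\<^sup>2 \<le> (k r)\<^sup>2"
      using k_lower_bound[of r] r by (intro power_mono) (auto simp: R_def)
    then show "1 / (2 * exp 1)\<^sup>2 * (1 / r) \<le> (k r)\<^sup>2"
      using r by (simp add: power_divide power_mult_distrib)
  qed simp
  also have "\<dots> \<le> (L2norm k)\<^sup>2"
    by (rule square_integrable_on_Icc(2)[OF k_square_integrable]) simp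
  finally show "(sqrt (ln (1 / (1 - s))) / (2 * exp 1))\<^sup>2 \<le> (L2norm k)\<^sup>2" .
qed simp

end

section \<open>The minimizing family\<close>

lemma tendsto_0_times_powr_minus:
  assumes u: "(u \<longlongrightarrow> (0::real)) at_top" and c: "0 \<le> c"
  shows "((\<lambda>r. u r * r powr (- c)) \<longlongrightarrow> 0) at_top"
proof (rule Lim_null_comparison)
  show "\<forall>\<^sub>F r in at_top. norm (u r * r powr (- c)) \<le> \<bar>u r\<bar>"
  proof (intro eventually_mono[OF eventually_ge_at_top[of 1]])
    fix r :: real assume "1 \<le> r"
    then have "r powr (- c) \<le> 1"
      using powr_mono[of "- c" 0 r] c by simp
    then show "norm (u r * r powr (- c)) \<le> \<bar>u r\<bar>"
      by (simp add: abs_mult mult_left_le)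
  qed
  show "((\<lambda>r. \<bar>u r\<bar>) \<longlongrightarrow> 0) at_top"
    using u by (rule tendsto_rabs_zero)
qed

section \<open>The incomplete Gamma function\<close>

lemma continuous_on_inc_Gamma_integrand:
  "continuous_on {0<..} (\<lambda>t::real. exp (- t) * t powr (\<zeta> - 1))"
  by (intro continuous_intros) auto

lemma powr_mult_powr_eq_inverse:
  fixes x :: real
  assumes "0 < x" "a + b = - 1"
  shows "x powr a * x powr b = 1 / x"
  unfolding powr_add[symmetric] assms(2) using assms(1) by (simp add: powr_minus_divide)

lemma inc_Gamma_integrable:
  fixes x :: real
  assumes z: "\<zeta> \<le> 1" and x: "0 < x"
  shows "set_integrable lborel {x<..} (\<lambda>t. exp (- t) * t powr (\<zeta> - 1))"
proof (rule set_integrable_exp_bounded[where l = 1 and A = "x powr (\<zeta> - 1)"])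
  show "continuous_on {0<..} (\<lambda>t::real. exp (- t) * t powr (\<zeta> - 1))"
    by (rule continuous_on_inc_Gamma_integrand)
  fix t assume "x < t"
  then show "\<bar>exp (- t) * t powr (\<zeta> - 1)\<bar> \<le> x powr (\<zeta> - 1) * exp (- (1 * t))"
    using x z by (simp add: abs_mult powr_mono2')
qed (use x in simp_all)

lemma inc_Gamma_has_real_derivative:
  assumes z: "\<zeta> \<le> 1" and x: "0 < x"
  shows "(inc_Gamma \<zeta> has_real_derivative - (exp (- x) * x powr (\<zeta> - 1))) (at x)"
  unfolding inc_Gamma_def[abs_def]
  by (rule has_real_derivative_set_integral_tail[OF continuous_on_inc_Gamma_integrand
        inc_Gamma_integrable[OF z] x])

lemma inc_Gamma_nonneg: "0 \<le> inc_Gamma \<zeta> x"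
  by (auto simp: inc_Gamma_def set_lebesgue_integral_def intro!: Bochner_Integration.integral_nonneg)

text \<open>Half of the exponent is spent on integrability in \<open>t\<close>, the other half is
  evaluated at \<open>x\<close> and kept as decay.\<close>

lemma inc_Gamma_le:
  assumes z: "\<zeta> \<le> 1" and x: "0 < x"
  shows "inc_Gamma \<zeta> x \<le> (LBINT t:{0<..}. exp (- (1 / 2 * t))) * x powr (\<zeta> - 1) * exp (- (1 / 2 * x))"
proof -
  have i: "set_integrable lborel {0<..} (\<lambda>t::real. exp (- (1 / 2 * t)))"
    by (rule set_integrable_exp_minus) simp
  have i2: "set_integrable lborel {x<..} (\<lambda>t::real. exp (- (1 / 2 * t)))"
    by (rule set_integrable_subset[OF i]) (use x in auto)
  have "inc_Gamma \<zeta> x \<le> (LBINT t:{x<..}. x powr (\<zeta> - 1) * exp (- (1 / 2 * x)) * exp (- (1 / 2 * t)))"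
    unfolding inc_Gamma_def
  proof (rule set_integral_mono[OF inc_Gamma_integrable[OF z x]])
    show "set_integrable lborel {x<..} (\<lambda>t. x powr (\<zeta> - 1) * exp (- (1 / 2 * x)) * exp (- (1 / 2 * t)))"
      using i2 by simp
    fix t assume "t \<in> {x<..}"
    then have t: "x < t" by simp
    have "exp (- t) \<le> exp (- (1 / 2 * x)) * exp (- (1 / 2 * t))"
      using t by (simp add: exp_add[symmetric])
    moreover have "t powr (\<zeta> - 1) \<le> x powr (\<zeta> - 1)"
      using x t z by (intro powr_mono2') auto
    ultimately have "exp (- t) * t powr (\<zeta> - 1) \<le> (exp (- (1 / 2 * x)) * exp (- (1 / 2 * t))) * x powr (\<zeta> - 1)"
      by (intro mult_mono) auto
    then show "exp (- t) * t powr (\<zeta> - 1) \<le> x powr (\<zeta> - 1) * exp (- (1 / 2 * x)) * exp (- (1 / 2 * t))"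
      by (simp add: mult_ac)
  qed
  also have "\<dots> = (LBINT t:{x<..}. exp (- (1 / 2 * t))) * (x powr (\<zeta> - 1) * exp (- (1 / 2 * x)))"
    by (simp add: mult_ac)
  also have "\<dots> \<le> (LBINT t:{0<..}. exp (- (1 / 2 * t))) * (x powr (\<zeta> - 1) * exp (- (1 / 2 * x)))"
  proof (rule mult_right_mono)
    show "(LBINT t:{x<..}. exp (- (1 / 2 * t))) \<le> (LBINT t:{0<..}. exp (- (1 / 2 * t)))"
      using i i2 x unfolding set_lebesgue_integral_def set_integrable_def
      by (intro integral_mono) (auto simp: indicator_def)
  qed simp
  finally show ?thesis
    by (simp add: mult_ac)
qed

text \<open>The \<open>\<gamma> r\<close>-dependent factor in the integrand of \<open>g4\<close> at
  \<open>a = 3/2\<close>, where \<open>(a - 1) / a = 1/3\<close>. It is a decaying solution of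
  \<open>(D - 1/3) phi = - exp (- x)\<close>.\<close>

definition phi :: "real \<Rightarrow> real" where
  "phi x = x powr (1 / 3) * inc_Gamma (- (1 / 3)) x"

lemma phi_ode: "euler_ode (1 / 3) phi (\<lambda>x. - exp (- x))"
  unfolding euler_ode_def
proof (intro allI impI)
  fix x :: real assume x: "0 < x"
  have "(phi has_real_derivative (1 / 3 * x powr (1 / 3 - 1) * inc_Gamma (- (1 / 3)) x
      + - (exp (- x) * x powr (- (1 / 3) - 1)) * x powr (1 / 3))) (at x)"
    unfolding phi_def[abs_def] using x
    by (intro DERIV_mult inc_Gamma_has_real_derivative) (auto intro!: derivative_eq_intros)
  also have "1 / 3 * x powr (1 / 3 - 1) * inc_Gamma (- (1 / 3)) x
      + - (exp (- x) * x powr (- (1 / 3) - 1)) * x powr (1 / 3) = (1 / 3 * phi x + - exp (- x)) / x"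
  proof -
    have 1: "x powr (1 / 3 - 1) = x powr (1 / 3) / x"
      by (subst powr_diff) (use x in simp)
    have "x powr (- (1 / 3) - 1) * x powr (1 / 3) = 1 / x"
      by (rule powr_mult_powr_eq_inverse[OF x]) simp
    then have 2: "exp (- x) * x powr (- (1 / 3) - 1) * x powr (1 / 3) = exp (- x) / x"
      by (simp only: mult.assoc) simp
    have "1 / 3 * x powr (1 / 3 - 1) * inc_Gamma (- (1 / 3)) x
      + - (exp (- x) * x powr (- (1 / 3) - 1)) * x powr (1 / 3) =
      1 / 3 * (x powr (1 / 3) / x) * inc_Gamma (- (1 / 3)) x - exp (- x) / x"
      unfolding 1 2[symmetric] by simp
    also have "\<dots> = (1 / 3 * phi x + - exp (- x)) / x"
      by (simp add: phi_def diff_divide_distrib)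
    finally show ?thesis .
  qed
  finally show "(phi has_real_derivative (1 / 3 * phi x + - exp (- x)) / x) (at x)" .
qed

lemma phi_nonneg: "0 \<le> phi x"
  by (simp add: phi_def inc_Gamma_nonneg)

lemma phi_le:
  assumes x: "0 < x"
  shows "phi x \<le> (LBINT t:{0<..}. exp (- (1 / 2 * t))) * exp (- (1 / 2 * x)) / x"
proof -
  define M where "M = (LBINT t:{0<..}. exp (- (1 / 2 * t)) :: real)"
  have p: "x powr (1 / 3) * x powr (- (1 / 3) - 1) = 1 / x"
    by (rule powr_mult_powr_eq_inverse[OF x]) simp
  have "phi x \<le> x powr (1 / 3) * (M * x powr (- (1 / 3) - 1) * exp (- (1 / 2 * x)))"
    unfolding phi_def M_def using x by (intro mult_left_mono inc_Gamma_le) auto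
  also have "\<dots> = (x powr (1 / 3) * x powr (- (1 / 3) - 1)) * (M * exp (- (1 / 2 * x)))"
    by (simp only: mult_ac)
  finally show ?thesis
    unfolding p by (simp add: M_def)
qed

section \<open>Decaying solutions with source \<open>k\<close>\<close>

context four_partite
begin

definition G1 where "G1 r = - integral {0..pi} (\<lambda>\<theta>. phi (gam \<xi> \<theta> * r) / w \<theta>)" for r

lemma phi_continuous: "0 < r \<Longrightarrow> continuous_on {0..pi} (\<lambda>\<theta>. phi (gam \<xi> \<theta> * r) / w \<theta>)"
  by (intro continuous_intros continuous_on_compose2[OF euler_ode_continuous_on[OF phi_ode]])
    (auto simp: gam_pos)

text \<open>\<open>D\<close> commutes with dilations, so every \<open>phi (\<gamma> r)\<close>
  solves the equation of \<open>phi\<close> with source \<open>- exp (- \<gamma> r)\<close>.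
  Averaging over \<open>\<theta>\<close>, with the sign of \<open>G1\<close>, gives the source
  \<open>k\<close>.\<close>

lemma G1_ode: "euler_ode (1 / 3) G1 k"
  unfolding euler_ode_def
proof (intro allI impI)
  fix r :: real assume r: "0 < r"
  have "((\<lambda>r. integral (cbox 0 pi) (\<lambda>\<theta>. phi (gam \<xi> \<theta> * r) / w \<theta>)) has_field_derivative
      integral (cbox 0 pi) (\<lambda>\<theta>. (1 / 3 * phi (gam \<xi> \<theta> * r) - exp (- (gam \<xi> \<theta> * r))) / (r * w \<theta>))) (at r within {0<..})"
  proof (rule leibniz_rule_field_derivative)
    fix x t :: real assume "x \<in> {0<..}"
    then have x: "0 < x" by simp
    have g: "0 < gam \<xi> t" by (rule gam_pos)
    have "((\<lambda>x. phi (gam \<xi> t * x)) has_real_derivative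
        (1 / 3 * phi (gam \<xi> t * x) + - exp (- (gam \<xi> t * x))) / (gam \<xi> t * x) * gam \<xi> t) (at x within {0<..})"
      using x g by (intro DERIV_chain2[OF euler_odeD[OF phi_ode]]) (auto intro!: derivative_eq_intros)
    then have "((\<lambda>x. phi (gam \<xi> t * x) / w t) has_real_derivative
        (1 / 3 * phi (gam \<xi> t * x) + - exp (- (gam \<xi> t * x))) / (gam \<xi> t * x) * gam \<xi> t / w t) (at x within {0<..})"
      by (rule DERIV_cdivide)
    also have "(1 / 3 * phi (gam \<xi> t * x) + - exp (- (gam \<xi> t * x))) / (gam \<xi> t * x) * gam \<xi> t / w t
       = (1 / 3 * phi (gam \<xi> t * x) - exp (- (gam \<xi> t * x))) / (x * w t)"
      using x g by simp
    finally show "((\<lambda>x. phi (gam \<xi> t * x) / w t) has_real_derivative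
        (1 / 3 * phi (gam \<xi> t * x) - exp (- (gam \<xi> t * x))) / (x * w t)) (at x within {0<..})" .
  next
    show "(\<lambda>\<theta>. phi (gam \<xi> \<theta> * x) / w \<theta>) integrable_on cbox 0 pi" if "x \<in> {0<..}" for x
      using that phi_continuous[of x] by (auto intro: integrable_continuous_real)
    show "continuous_on ({0<..} \<times> cbox 0 pi)
        (\<lambda>(x, t). (1 / 3 * phi (gam \<xi> t * x) - exp (- (gam \<xi> t * x))) / (x * w t))"
      unfolding split_beta
      by (intro continuous_intros continuous_on_compose2[OF euler_ode_continuous_on[OF phi_ode]])
        (auto simp: gam_pos)
  qed (use r in auto)
  moreover have "at r within {0<..} = at r"
    using r by (intro at_within_open) auto
  ultimately have d: "(G1 has_real_derivative
      - integral {0..pi} (\<lambda>\<theta>. (1 / 3 * phi (gam \<xi> \<theta> * r) - exp (- (gam \<xi> \<theta> * r))) / (r * w \<theta>))) (at r)"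
    unfolding G1_def[abs_def] by (intro DERIV_minus) simp
  have "((\<lambda>\<theta>. (1 / 3 * (phi (gam \<xi> \<theta> * r) / w \<theta>) - exp (- (gam \<xi> \<theta> * r)) / w \<theta>) / r) has_integral
      (1 / 3 * integral {0..pi} (\<lambda>\<theta>. phi (gam \<xi> \<theta> * r) / w \<theta>) - k r) / r) {0..pi}"
    unfolding k_def using r
    by (intro has_integral_divide has_integral_diff has_integral_mult_right integrable_integral
          integrable_continuous_real kernel_continuous phi_continuous)
  also have "(\<lambda>\<theta>. (1 / 3 * (phi (gam \<xi> \<theta> * r) / w \<theta>) - exp (- (gam \<xi> \<theta> * r)) / w \<theta>) / r) =
      (\<lambda>\<theta>. (1 / 3 * phi (gam \<xi> \<theta> * r) - exp (- (gam \<xi> \<theta> * r))) / (r * w \<theta>))"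
    by (auto simp: diff_divide_distrib mult.commute)
  finally have "- integral {0..pi} (\<lambda>\<theta>. (1 / 3 * phi (gam \<xi> \<theta> * r) - exp (- (gam \<xi> \<theta> * r))) / (r * w \<theta>))
      = (1 / 3 * G1 r + k r) / r"
    by (simp add: integral_unique G1_def diff_divide_distrib)
  with d show "(G1 has_real_derivative (1 / 3 * G1 r + k r) / r) (at r)"
    by simp
qed

text \<open>Meant for large \<open>r\<close>: it controls limits and tail integrals at infinity.
  Square integrability near 0 is obtained from Hardy's inequality instead.\<close>

lemma G1_bound:
  obtains A where "0 \<le> A" "\<And>r. 0 < r \<Longrightarrow> \<bar>G1 r\<bar> \<le> A * exp (- ((1 - s) / 8 * r)) / r"
proof
  define M where "M = (LBINT t:{0<..}. exp (- (1 / 2 * t)) :: real)"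
  define c where "c = (1 - s) / 4"
  define A where "A = pi * M / (c * (1 - s))"
  have M: "0 \<le> M"
    by (auto simp: M_def set_lebesgue_integral_def intro!: Bochner_Integration.integral_nonneg)
  have c: "0 < c" using s by (simp add: c_def)
  show "0 \<le> A"
    using M c s by (simp add: A_def)
  fix r :: real assume r: "0 < r"
  have nn: "0 \<le> phi (gam \<xi> \<theta> * r) / w \<theta>" for \<theta>
    using phi_nonneg w_bounds(3)[of \<theta>] by simp
  have "0 \<le> integral {0..pi} (\<lambda>\<theta>. phi (gam \<xi> \<theta> * r) / w \<theta>)"
    by (intro integral_nonneg integrable_continuous_real phi_continuous r nn)
  then have "\<bar>G1 r\<bar> = integral {0..pi} (\<lambda>\<theta>. phi (gam \<xi> \<theta> * r) / w \<theta>)"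
    by (simp add: G1_def)
  also have "\<dots> \<le> integral {0..pi} (\<lambda>\<theta>. M * exp (- (1 / 2 * (c * r))) / (c * r) / (1 - s))"
  proof (intro integral_le integrable_continuous_real phi_continuous r continuous_on_const)
    fix \<theta> :: real
    have g: "c * r \<le> gam \<xi> \<theta> * r" "0 < gam \<xi> \<theta> * r"
      using r gam_lower[of \<theta>] gam_pos[of \<theta>] by (auto simp: c_def)
    have "phi (gam \<xi> \<theta> * r) \<le> M * exp (- (1 / 2 * (gam \<xi> \<theta> * r))) / (gam \<xi> \<theta> * r)"
      using phi_le[OF g(2)] by (simp add: M_def)
    also have "\<dots> \<le> M * exp (- (1 / 2 * (c * r))) / (c * r)"
      using g M c r by (intro frac_le mult_left_mono) auto
    finally have "phi (gam \<xi> \<theta> * r) \<le> M * exp (- (1 / 2 * (c * r))) / (c * r)" .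
    then show "phi (gam \<xi> \<theta> * r) / w \<theta> \<le> M * exp (- (1 / 2 * (c * r))) / (c * r) / (1 - s)"
      using phi_nonneg[of "gam \<xi> \<theta> * r"] w_bounds[of \<theta>] s M c r by (intro frac_le) auto
  qed
  also have "\<dots> = A * exp (- (1 / 2 * (c * r))) / r"
    by (simp add: A_def mult_ac)
  also have "1 / 2 * (c * r) = (1 - s) / 8 * r"
    by (simp add: c_def)
  finally show "\<bar>G1 r\<bar> \<le> A * exp (- ((1 - s) / 8 * r)) / r" .
qed

lemma G1_tendsto_0: "(G1 \<longlongrightarrow> 0) at_top"
proof -
  obtain A where A: "\<And>r. 0 < r \<Longrightarrow> \<bar>G1 r\<bar> \<le> A * exp (- ((1 - s) / 8 * r)) / r"
    using G1_bound by blast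
  show ?thesis
  proof (rule Lim_null_comparison)
    show "\<forall>\<^sub>F r in at_top. norm (G1 r) \<le> A * exp (- ((1 - s) / 8 * r)) / r"
      using A by (intro eventually_mono[OF eventually_gt_at_top[of 0]]) simp
    have "0 < (1 - s) / 8" using s by simp
    then show "((\<lambda>r. A * exp (- ((1 - s) / 8 * r)) / r) \<longlongrightarrow> 0) at_top"
      by real_asymp
  qed
qed

definition tail where "tail r = (LBINT t:{r<..}. t powr (- 5 / 3) * G1 t)" for r

text \<open>Variation of constants for \<open>(D - 2/3) G2 = G1\<close>, integrating from infinity
  so that no multiple of \<open>r powr (2 / 3)\<close> is present there.\<close>

definition G2 where "G2 r = - (r powr (2 / 3)) * tail r" for r

lemma tail_continuous: "continuous_on {0<..} (\<lambda>t. t powr (- 5 / 3) * G1 t)"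
  by (intro continuous_intros euler_ode_continuous_on[OF G1_ode]) auto

lemma tail_integrable:
  assumes x: "0 < x"
  shows "set_integrable lborel {x<..} (\<lambda>t. t powr (- 5 / 3) * G1 t)"
proof -
  obtain A where A: "0 \<le> A" "\<And>r. 0 < r \<Longrightarrow> \<bar>G1 r\<bar> \<le> A * exp (- ((1 - s) / 8 * r)) / r"
    using G1_bound by blast
  show ?thesis
  proof (rule set_integrable_exp_bounded[OF tail_continuous])
    show "0 < (1 - s) / 8" using s by simp
    show "0 \<le> x" using x by simp
    fix t assume t: "x < t"
    have "\<bar>t powr (- 5 / 3) * G1 t\<bar> = t powr (- 5 / 3) * \<bar>G1 t\<bar>"
      by (simp add: abs_mult)
    also have "\<dots> \<le> x powr (- 5 / 3) * (A * exp (- ((1 - s) / 8 * t)) / x)"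
    proof (rule mult_mono)
      show "t powr (- 5 / 3) \<le> x powr (- 5 / 3)"
        using x t by (intro powr_mono2') auto
      have "\<bar>G1 t\<bar> \<le> A * exp (- ((1 - s) / 8 * t)) / t"
        using A(2) x t by simp
      also have "\<dots> \<le> A * exp (- ((1 - s) / 8 * t)) / x"
        using A(1) x t by (intro frac_le) auto
      finally show "\<bar>G1 t\<bar> \<le> A * exp (- ((1 - s) / 8 * t)) / x" .
    qed auto
    finally show "\<bar>t powr (- 5 / 3) * G1 t\<bar> \<le> x powr (- 5 / 3) * A / x * exp (- ((1 - s) / 8 * t))"
      by simp
  qed
qed

lemma G2_ode: "euler_ode (2 / 3) G2 G1"
  unfolding euler_ode_def
proof (intro allI impI)
  fix r :: real assume r: "0 < r"
  have dV: "(tail has_real_derivative - (r powr (- 5 / 3) * G1 r)) (at r)"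
    unfolding tail_def[abs_def]
    by (rule has_real_derivative_set_integral_tail[OF tail_continuous tail_integrable r])
  have "(G2 has_real_derivative
      (- (2 / 3 * r powr (2 / 3 - 1))) * tail r + - (r powr (- 5 / 3) * G1 r) * (- (r powr (2 / 3)))) (at r)"
    unfolding G2_def[abs_def] using r
    by (intro DERIV_mult dV) (auto intro!: derivative_eq_intros)
  also have "(- (2 / 3 * r powr (2 / 3 - 1))) * tail r + - (r powr (- 5 / 3) * G1 r) * (- (r powr (2 / 3)))
      = (2 / 3 * G2 r + G1 r) / r"
  proof -
    have 1: "r powr (2 / 3 - 1) = r powr (2 / 3) / r"
      by (subst powr_diff) (use r in simp)
    have 2: "r powr (- 5 / 3) * r powr (2 / 3) = 1 / r"
      by (rule powr_mult_powr_eq_inverse[OF r]) simp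
    have "- (r powr (- 5 / 3) * G1 r) * (- (r powr (2 / 3))) = (r powr (- 5 / 3) * r powr (2 / 3)) * G1 r"
      by simp
    then show ?thesis
      unfolding 1 2 by (simp add: G2_def add_divide_distrib diff_divide_distrib)
  qed
  finally show "(G2 has_real_derivative (2 / 3 * G2 r + G1 r) / r) (at r)" .
qed

lemma G2_scaled_tendsto_0: "((\<lambda>r. G2 r * r powr (- (2 / 3))) \<longlongrightarrow> 0) at_top"
proof -
  have "(tail \<longlongrightarrow> 0) at_top"
    unfolding tail_def[abs_def] by (rule set_integral_tail_tendsto_0[OF tail_integrable[OF zero_less_one]])
  then have "((\<lambda>r. - tail r) \<longlongrightarrow> 0) at_top"
    using tendsto_minus by fastforce
  then show ?thesis
  proof (rule Lim_transform_eventually, intro eventually_mono[OF eventually_gt_at_top[of 0]])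
    fix r :: real assume "0 < r"
    then have "r powr (2 / 3) * r powr (- (2 / 3)) = 1"
      by (simp add: powr_add[symmetric])
    then show "- tail r = G2 r * r powr (- (2 / 3))"
      by (simp add: G2_def mult.assoc mult.left_commute)
  qed
qed

text \<open>Near-equality is applied twice: \<open>E k = e\<close> controls \<open>E G1\<close> with
  \<open>c = 1/3\<close>, and \<open>E G1\<close> in turn controls \<open>E G2\<close> with
  \<open>c = 2/3\<close>.\<close>

lemma extremal_bounds:
  shows G1_square_integrable: "square_integrable G1"
    and G2_square_integrable: "square_integrable G2"
    and k_norm_le: "L2norm k \<le> 35 / 36 * L2norm G2 + 18"
proof -
  have c: "- 1 / 2 < (1 / 3 :: real)" "- 1 / 2 < (2 / 3 :: real)"
    by simp_all
  have limk: "((\<lambda>r. k r * r powr (- (1 / 3))) \<longlongrightarrow> 0) at_top"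
    by (rule tendsto_0_times_powr_minus[OF k_tendsto_0]) simp
  have limG1: "((\<lambda>r. G1 r * r powr (- (1 / 3))) \<longlongrightarrow> 0) at_top" "((\<lambda>r. G1 r * r powr (- (2 / 3))) \<longlongrightarrow> 0) at_top"
    by (rule tendsto_0_times_powr_minus[OF G1_tendsto_0]; simp)+
  note 1 = hardy_near_equality[OF G1_ode k_ode k_square_integrable e_square_integrable c(1) limG1(1) limk]
  note 2 = hardy_near_equality[OF G2_ode 1(1-3) c(2) G2_scaled_tendsto_0 limG1(2)]
  show "square_integrable G1" by (rule 1(2))
  show "square_integrable G2" by (rule 2(2))
  \<comment> \<open>Here \<open>35/36 = 5/6 * 7/6\<close>. The errors add up to at most
    \<open>(5/6 * 6/7 + 1) * 6/5 * 6\<close>, which is below 18.\<close>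
  show "L2norm k \<le> 35 / 36 * L2norm G2 + 18"
    using 1(4,5) 2(4,5) e_norm by simp
qed

text \<open>Positivity of the source \<open>k\<close> passes up the chain: a solution of norm zero
  would have a vanishing source.\<close>

lemma norms_pos: "0 < L2norm G1" "0 < L2norm G2"
proof -
  have 1: "L2norm G1 \<noteq> 0"
    using euler_ode_eq_0(2)[OF G1_ode G1_square_integrable _ zero_less_one] k_bounds(1)[OF zero_less_one] by auto
  have "L2norm G2 \<noteq> 0"
  proof
    assume z: "L2norm G2 = 0"
    have "L2norm G1 = L2norm (\<lambda>r. 0 * G1 r)"
      using euler_ode_eq_0(2)[OF G2_ode G2_square_integrable z] by (intro L2norm_cong) simp
    also have "\<dots> = 0"
      by (subst L2norm_cmult) simp
    finally show False
      using 1 by simp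
  qed
  with 1 show "0 < L2norm G1" "0 < L2norm G2"
    by (simp_all add: less_le)
qed

section \<open>Identification with the family in the statement\<close>

lemma ellipticK_pos: "0 < ellipticK \<xi>"
proof -
  have xs: "0 < 1 - \<xi>\<^sup>2 * (sin \<theta>)\<^sup>2" "1 - \<xi>\<^sup>2 * (sin \<theta>)\<^sup>2 \<le> 1" for \<theta>
  proof -
    have "\<xi>\<^sup>2 * (sin \<theta>)\<^sup>2 \<le> \<xi>\<^sup>2 * 1"
      by (intro mult_left_mono) (auto simp: abs_square_le_1)
    also have "\<dots> < 1"
      using xi by (simp add: abs_square_less_1)
    finally show "0 < 1 - \<xi>\<^sup>2 * (sin \<theta>)\<^sup>2" by simp
  qed simp
  have c: "continuous_on {0..pi / 2} (\<lambda>\<theta>. 1 / sqrt (1 - \<xi>\<^sup>2 * (sin \<theta>)\<^sup>2))"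
    using xs(1) by (intro continuous_intros) (metis less_irrefl real_sqrt_eq_zero_cancel_iff)
  have "0 < pi / 2" by simp
  also have "pi / 2 = integral {0..pi / 2} (\<lambda>\<theta>::real. 1::real)"
    by simp
  also have "\<dots> \<le> integral {0..pi / 2} (\<lambda>\<theta>. 1 / sqrt (1 - \<xi>\<^sup>2 * (sin \<theta>)\<^sup>2))"
    using xs by (intro integral_le integrable_continuous_real c) (auto simp del: diff_gt_0_iff_gt)
  also have "\<dots> = ellipticK \<xi>"
    unfolding ellipticK_def
    by (rule set_borel_integral_eq_integral(2)[OF borel_integrable_atLeastAtMost'[OF c], symmetric])
  finally show ?thesis .
qed

text \<open>The two minus signs, in \<open>g4\<close> and in \<open>G1\<close>, cancel. Positivity
  of the factor matters because normalization divides by its absolute value, so \<open>f4\<close> is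
  \<open>G1\<close> over its norm without a sign.\<close>

lemma g4_eq: "\<exists>C>0. \<forall>r>0. g4 (3 / 2) \<xi> r = C * G1 r"
proof (intro exI[of _ "1 / (3 / 2 * sqrt (2 * pi * ellipticK \<xi>))"] conjI allI impI)
  show "0 < 1 / (3 / 2 * sqrt (2 * pi * ellipticK \<xi>))"
    using ellipticK_pos by simp
  fix r :: real assume r: "0 < r"
  have "(LBINT \<theta>:{0..pi}. phi (gam \<xi> \<theta> * r) / w \<theta>) = integral {0..pi} (\<lambda>\<theta>. phi (gam \<xi> \<theta> * r) / w \<theta>)"
    by (rule set_borel_integral_eq_integral(2)[OF borel_integrable_atLeastAtMost'[OF phi_continuous[OF r]]])
  then show "g4 (3 / 2) \<xi> r = 1 / (3 / 2 * sqrt (2 * pi * ellipticK \<xi>)) * G1 r"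
    by (simp add: g4_def G1_def phi_def w_def s_def)
qed

lemma f4_eq:
  assumes "0 < r"
  shows "f4 (3 / 2) \<xi> r = G1 r / L2norm G1"
proof -
  obtain C where C: "0 < C" "\<And>r. 0 < r \<Longrightarrow> g4 (3 / 2) \<xi> r = C * G1 r"
    using g4_eq by blast
  have "L2norm (g4 (3 / 2) \<xi>) = L2norm (\<lambda>r. C * G1 r)"
    by (intro L2norm_cong C(2))
  then show ?thesis
    using C assms by (simp add: f4_def L2norm_cmult)
qed

lemma g6_eq:
  assumes "0 < r"
  shows "g6 \<xi> r = 1 / (3 * L2norm G1) * G2 r"
proof -
  have "(LBINT t:{r<..}. t powr (- 5 / 3) * f4 (3 / 2) \<xi> t) =
      (LBINT t:{r<..}. 1 / L2norm G1 * (t powr (- 5 / 3) * G1 t))"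
    using assms f4_eq by (intro set_lebesgue_integral_cong) auto
  also have "\<dots> = 1 / L2norm G1 * tail r"
    unfolding tail_def by (rule set_integral_mult_right)
  finally show ?thesis
    by (simp add: g6_def G2_def)
qed

lemma f6_eq:
  assumes "0 < r"
  shows "f6 \<xi> r = 1 / L2norm G2 * G2 r"
proof -
  have "L2norm (g6 \<xi>) = L2norm (\<lambda>r. 1 / (3 * L2norm G1) * G2 r)"
    by (intro L2norm_cong g6_eq)
  then show ?thesis
    unfolding L2norm_cmult using assms norms_pos by (simp add: f6_def g6_eq)
qed

text \<open>Each derivative is eliminated through the equations for \<open>G2\<close>,
  \<open>G1\<close> and \<open>k\<close>. In operator form the result is \<open>9/2 D k\<close>, and
  \<open>D k = e - k/2\<close> because \<open>D = E - 1/2\<close>.\<close>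

lemma f6_derivs:
  assumes r: "0 < r"
  shows "\<And>j. j < 3 \<Longrightarrow> ((deriv ^^ j) (f6 \<xi>)) differentiable (at r)"
    and "r * deriv (f6 \<xi>) r + 9 * r ^ 2 * (deriv ^^ 2) (f6 \<xi>) r + 9 / 2 * r ^ 3 * (deriv ^^ 3) (f6 \<xi>) r
      = 9 / 2 / L2norm G2 * (e r + - 1 / 2 * k r)"
proof -
  define N where "N = 1 / L2norm G2"
  define a1 where "a1 r = N * ((2 / 3 * G2 r + G1 r) / r)" for r
  \<comment> \<open>From \<open>r^2 d^2/dr^2 = D (D - 1)\<close>: applied to \<open>G2\<close> it
    gives \<open>k - 2/9 G2\<close>, the terms in \<open>G1\<close> cancelling.\<close>
  define a2 where "a2 r = N * ((k r - 2 / 9 * G2 r) / r\<^sup>2)" for r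
  define a3 where "a3 r = N * (((- 1 / 2 * k r + e r) / r - 2 / 9 * ((2 / 3 * G2 r + G1 r) / r)) / r\<^sup>2
      - 2 * (k r - 2 / 9 * G2 r) / r ^ 3)" for r
  have d1: "(f6 \<xi> has_real_derivative a1 r) (at r)" if r: "0 < r" for r
    unfolding a1_def
    by (rule has_field_derivative_transform_within_open[OF DERIV_cmult[OF euler_odeD[OF G2_ode r]], of "{0<..}"])
      (use r in \<open>auto simp: f6_eq N_def\<close>)
  have d2: "(a1 has_real_derivative a2 r) (at r)" if r: "0 < r" for r
  proof -
    have "(a1 has_real_derivative N * (((2 / 3 * ((2 / 3 * G2 r + G1 r) / r) + (1 / 3 * G1 r + k r) / r) * r
        - (2 / 3 * G2 r + G1 r) * 1) / (r * r))) (at r)"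
      unfolding a1_def[abs_def] using r
      by (intro DERIV_cmult DERIV_divide DERIV_add DERIV_ident euler_odeD[OF G2_ode] euler_odeD[OF G1_ode]) auto
    also have "N * (((2 / 3 * ((2 / 3 * G2 r + G1 r) / r) + (1 / 3 * G1 r + k r) / r) * r
        - (2 / 3 * G2 r + G1 r) * 1) / (r * r)) = a2 r"
      using r by (simp add: a2_def field_simps power2_eq_square)
    finally show ?thesis .
  qed
  have d3: "(a2 has_real_derivative a3 r) (at r)" if r: "0 < r" for r
  proof -
    have "(a2 has_real_derivative N * ((((- 1 / 2 * k r + e r) / r - 2 / 9 * ((2 / 3 * G2 r + G1 r) / r)) * r\<^sup>2
        - (k r - 2 / 9 * G2 r) * (2 * r)) / (r\<^sup>2 * r\<^sup>2))) (at r)"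
      unfolding a2_def[abs_def] using r
      by (intro DERIV_cmult DERIV_divide DERIV_diff euler_odeD[OF G2_ode] euler_odeD[OF k_ode])
        (auto intro!: derivative_eq_intros)
    also have "N * ((((- 1 / 2 * k r + e r) / r - 2 / 9 * ((2 / 3 * G2 r + G1 r) / r)) * r\<^sup>2
        - (k r - 2 / 9 * G2 r) * (2 * r)) / (r\<^sup>2 * r\<^sup>2)) = a3 r"
      using r by (simp add: a3_def field_simps power2_eq_square power3_eq_cube)
    finally show ?thesis .
  qed
  have h: "deriv (f6 \<xi>) r = a1 r" "(deriv ^^ 2) (f6 \<xi>) r = a2 r" "(deriv ^^ 3) (f6 \<xi>) r = a3 r"
    using higher_derivs_eq(1-3)[of "f6 \<xi>" a1 a2 a3 r] d1 d2 d3 r by blast+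
  show "((deriv ^^ j) (f6 \<xi>)) differentiable (at r)" if "j < 3" for j
    using higher_derivs_eq(4)[of "f6 \<xi>" a1 a2 a3 r] d1 d2 d3 r that by blast
  have "r * a1 r + 9 * r ^ 2 * a2 r + 9 / 2 * r ^ 3 * a3 r = 9 / 2 * N * (e r + - 1 / 2 * k r)"
    using r by (simp add: a1_def a2_def a3_def field_simps power2_eq_square power3_eq_cube)
  then show "r * deriv (f6 \<xi>) r + 9 * r ^ 2 * (deriv ^^ 2) (f6 \<xi>) r + 9 / 2 * r ^ 3 * (deriv ^^ 3) (f6 \<xi>) r
      = 9 / 2 / L2norm G2 * (e r + - 1 / 2 * k r)"
    unfolding h(1-3) by (simp add: N_def)
qed

lemma normalized_f6: "normalized (f6 \<xi>)"
proof -
  have "L2norm (f6 \<xi>) = L2norm (\<lambda>r. 1 / L2norm G2 * G2 r)"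
    by (intro L2norm_cong f6_eq)
  also have "\<dots> = 1"
    unfolding L2norm_cmult using norms_pos by simp
  finally show ?thesis
    using f6_derivs(1) by (auto simp: normalized_def)
qed

text \<open>\<open>L\<close> measures how far the norm of \<open>k\<close> exceeds the error 18. The
  estimate tends to the lower bound as \<open>L\<close> grows, since
  \<open>81/2240 * (35/72)^2 = 35/4096\<close>.\<close>

lemma Z6_f6_le:
  assumes L: "0 < L" "L \<le> L2norm k - 18"
  shows "Z6 (f6 \<xi>) \<le> ennreal (81 / 2240 * (35 / 72 + 15 / L)\<^sup>2)"
proof -
  define u where "u r = 9 / 2 / L2norm G2 * (e r + - 1 / 2 * k r)" for r
  have sq: "square_integrable (\<lambda>r. e r + - 1 / 2 * k r)"
    by (intro square_integrable_add square_integrable_cmult e_square_integrable k_square_integrable)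
  have squ: "square_integrable u"
    unfolding u_def[abs_def] by (rule square_integrable_cmult[OF sq])
  have eq: "ennreal ((r * deriv (f6 \<xi>) r + 9 * r ^ 2 * (deriv ^^ 2) (f6 \<xi>) r
        + 9 / 2 * r ^ 3 * (deriv ^^ 3) (f6 \<xi>) r)\<^sup>2) * indicator {0<..} r =
      ennreal ((9 / 2 / L2norm G2 * (e r + - 1 / 2 * k r))\<^sup>2) * indicator {0<..} r" for r
  proof (cases "0 < r")
    case True
    then show ?thesis
      by (simp only: f6_derivs(2))
  qed simp
  have "Z6 (f6 \<xi>) = ennreal (1 / 560) * (\<integral>\<^sup>+ r\<in>{0<..}. ennreal ((u r)\<^sup>2) \<partial>lborel)"
    unfolding Z6_def u_def by (simp only: eq)
  also have "\<dots> = ennreal (1 / 560 * (L2norm u)\<^sup>2)"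
    unfolding nn_integral_square_integrable[OF squ] by (rule ennreal_mult[symmetric]) simp_all
  also have "1 / 560 * (L2norm u)\<^sup>2 \<le> 81 / 2240 * (35 / 72 + 15 / L)\<^sup>2"
  proof -
    define n where "n = L2norm G2"
    have n: "0 < n" using norms_pos by (simp add: n_def)
    have Ln: "L \<le> n"
      using L k_norm_le n by (simp add: n_def)
    have "L2norm (\<lambda>r. e r + - 1 / 2 * k r) \<le> L2norm e + L2norm (\<lambda>r. - 1 / 2 * k r)"
      by (intro L2norm_triangle square_integrable_cmult e_square_integrable k_square_integrable)
    \<comment> \<open>Half of the bound on the norm of \<open>k\<close> gives
      \<open>35/72 n + 9\<close>, and \<open>e\<close> contributes 6.\<close>
    also have "\<dots> \<le> 35 / 72 * n + 15"
      unfolding L2norm_cmult using e_norm k_norm_le by (simp add: n_def)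
    finally have "L2norm (\<lambda>r. e r + - 1 / 2 * k r) / n \<le> (35 / 72 * n + 15) / n"
      using n by (intro divide_right_mono) auto
    also have "\<dots> = 35 / 72 + 15 / n"
      using n by (simp add: field_simps)
    also have "\<dots> \<le> 35 / 72 + 15 / L"
      using L Ln by (intro add_left_mono frac_le) auto
    finally have 1: "L2norm (\<lambda>r. e r + - 1 / 2 * k r) / n \<le> 35 / 72 + 15 / L" .
    have "L2norm u = 9 / 2 * (L2norm (\<lambda>r. e r + - 1 / 2 * k r) / n)"
      unfolding u_def[abs_def] L2norm_cmult using n by (simp add: n_def)
    \<comment> \<open>The factor is \<open>81/2240 = (9/2)^2 / 560\<close>.\<close>
    then have "1 / 560 * (L2norm u)\<^sup>2 = 81 / 2240 * (L2norm (\<lambda>r. e r + - 1 / 2 * k r) / n)\<^sup>2"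
      by (simp add: power2_eq_square)
    also have "\<dots> \<le> 81 / 2240 * (35 / 72 + 15 / L)\<^sup>2"
      using 1 n by (intro mult_left_mono power_mono) auto
    finally show ?thesis .
  qed
  finally show ?thesis
    by (simp add: ennreal_leI)
qed

end

theorem theorem4:
  shows "(INF f\<in>{f. normalized f}. Z6 f) = ennreal (35 / 4096)
    \<and> (\<forall>\<xi>. 0 < \<xi> \<and> \<xi> < 1 \<longrightarrow> normalized (f6 \<xi>))
    \<and> ((\<lambda>\<xi>. Z6 (f6 \<xi>)) \<longlongrightarrow> ennreal (35 / 4096)) (at_left 1)"
proof -
  have loc: "four_partite \<xi>" if "0 < \<xi>" "\<xi> < 1" for \<xi>
    using that by unfold_locales
  have norm: "normalized (f6 \<xi>)" if "0 < \<xi>" "\<xi> < 1" for \<xi>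
    by (rule four_partite.normalized_f6[OF loc[OF that]])
  \<comment> \<open>The logarithmic lower bound for the norm of \<open>k\<close>, reduced by the
    error 18; it tends to infinity because \<open>sqrt \<xi>\<close> tends to 1.\<close>
  define L where "L \<xi> = sqrt (ln (1 / (1 - sqrt \<xi>))) / (2 * exp 1) - 18" for \<xi> :: real
  have L: "filterlim L at_top (at_left 1)"
    unfolding L_def by real_asymp
  then have L_pos: "eventually (\<lambda>\<xi>. 0 < L \<xi>) (at_left 1)"
    by (simp add: filterlim_at_top_dense)
  have L_lim: "((\<lambda>\<xi>. 15 / L \<xi>) \<longlongrightarrow> 0) (at_left 1)"
    by (rule tendsto_divide_0[OF tendsto_const filterlim_at_top_imp_at_infinity[OF L]])
  have xi: "eventually (\<lambda>\<xi>::real. 0 < \<xi> \<and> \<xi> < 1) (at_left 1)"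
    using eventually_at_left_real[of 0 1] by simp
  have lower: "eventually (\<lambda>\<xi>. ennreal (35 / 4096) \<le> Z6 (f6 \<xi>)) (at_left 1)"
    using xi by eventually_elim (auto intro: Z6_lower_bound norm)
  have upper: "eventually (\<lambda>\<xi>. Z6 (f6 \<xi>) \<le> ennreal (81 / 2240 * (35 / 72 + 15 / L \<xi>)\<^sup>2)) (at_left 1)"
    using xi L_pos
  proof eventually_elim
    case (elim \<xi>)
    interpret four_partite \<xi>
      using elim by (intro loc) auto
    show ?case
      using elim k_norm_lower_bound by (intro Z6_f6_le) (auto simp: L_def s_def)
  qed
  have "((\<lambda>\<xi>. 81 / 2240 * (35 / 72 + 15 / L \<xi>)\<^sup>2) \<longlongrightarrow> 81 / 2240 * (35 / 72 + 0)\<^sup>2) (at_left 1)"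
    by (intro tendsto_intros L_lim)
  also have "81 / 2240 * (35 / 72 + 0)\<^sup>2 = (35 / 4096 :: real)"
    by (simp add: power2_eq_square)
  finally have "((\<lambda>\<xi>. ennreal (81 / 2240 * (35 / 72 + 15 / L \<xi>)\<^sup>2)) \<longlongrightarrow> ennreal (35 / 4096)) (at_left 1)"
    by (rule tendsto_ennrealI)
  from tendsto_sandwich[OF lower upper tendsto_const this]
  have lim: "((\<lambda>\<xi>. Z6 (f6 \<xi>)) \<longlongrightarrow> ennreal (35 / 4096)) (at_left 1)" .
  \<comment> \<open>The infimum lies below every value along the family, hence below their
    limit.\<close>
  have "(INF f\<in>{f. normalized f}. Z6 f) \<le> ennreal (35 / 4096)"
  proof (rule tendsto_lowerbound[OF lim])
    show "eventually (\<lambda>\<xi>. (INF f\<in>{f. normalized f}. Z6 f) \<le> Z6 (f6 \<xi>)) (at_left 1)"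
      using xi by eventually_elim (auto intro: INF_lower norm)
  qed simp
  moreover have "ennreal (35 / 4096) \<le> (INF f\<in>{f. normalized f}. Z6 f)"
    by (rule INF_greatest) (auto intro: Z6_lower_bound)
  ultimately have "(INF f\<in>{f. normalized f}. Z6 f) = ennreal (35 / 4096)"
    by (rule antisym)
  with norm lim show ?thesis
    by blast
qed

end
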